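(* For every point $P$ in the interior of the unit square $[0,1]\times[0,1]$ there exists some $\epsilon(P)$ with $0<\epsilon(P)\leq \frac{1}{17}$ such that for all but countably many slopes $s\in[3,3+\epsilon(P)]$ the particle starting from $P$ with the single-wall bomb and slope $s$ tunnels, and the tunnel has slope $1+\frac{3s-9}{25-8s}$. If $s$ (in this interval) is rational, any such tunnel is periodic. If $s$ is irrational, the tunnel is not periodic; consequently there are uncountably many aperiodic tunnels from every starting point $P$ in the interior of the square (that is, uncountably many slopes for which the particle starting at $P$ digs a tunnel that is not periodic).
   Context: Dynamics (single-wall bomb). The plane is covered by the unit square grid. The walls are the unit-length edges joining adjacent points of $\mathbb{Z}^2$ (each horizontal or vertical); the corners are the points of $\mathbb{Z}^2$. Initially every wall is solid. A particle starts at a given point; "slope $s$" means its initial direction is $(1,s)/\sqrt{1+s^2}$ (so up and to the right for $s>0$). It moves in a straight line until it collides with a solid wall; it then reflects off, preserving the angle of incidence, and the wall hit is permanently erased. It passes freely through erased walls. If it reaches a corner it stops (whether or not the adjacent walls have been erased). Tunnels. A band is the set of points of the plane within a given finite distance of some ray $\ell$. A particle tunnels (digs a tunnel) if it runs infinitely (without hitting a corner) and, for some $r$, every wall it collides with outside a disc of radius $r$ is contained in a finite union of bands. The tunnel is periodic if, for sufficiently large $r$, there is a positive integer $k$ such that (for collisions outside the disc) the wall hit in collision $n+k$ is always of the same type (horizontal/vertical) as the wall hit in collision $n$, and the displacement from the wall hit in collision $n$ to that hit in collision $n+k$ depends only on which band contains the wall hit in collision $n$; the least such $k$ is the period. The slope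 of a tunnel is the absolute value of the slope of the ray defining one of its bands. *)

theory Defs
  imports "HOL-Analysis.Analysis"
begin

type_synonym point = "real \<times> real"

definition corners :: "point set" where
  "corners = \<int> \<times> \<int>"

text \<open>A wall is given by its type and its left (for horizontal walls) or lower (for vertical
  walls) endpoint.\<close>

datatype wall =
    is_Horizontal: Horizontal (base: "int \<times> int")
  | is_Vertical: Vertical (base: "int \<times> int")

fun wall_set :: "wall \<Rightarrow> point set" where
  "wall_set (Horizontal (i, j)) =
     closed_segment (real_of_int i, real_of_int j) (real_of_int i + 1, real_of_int j)"
| "wall_set (Vertical (i, j)) =
     closed_segment (real_of_int i, real_of_int j) (real_of_int i, real_of_int j + 1)"

fun reflect :: "wall \<Rightarrow> point \<Rightarrow> point" where
  "reflect (Horizontal _) (vx, vy) = (vx, - vy)"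
| "reflect (Vertical _) (vx, vy) = (- vx, vy)"

text \<open>From position \<open>p\<close> with velocity \<open>v\<close>, when the walls in \<open>E\<close> have been erased, the next
  collision is with the wall \<open>w\<close>, after time \<open>t\<close>; no corner is met up to and including time \<open>t\<close>.
  As two different walls meet only in corners, \<open>w\<close> and \<open>t\<close> are unique. The instant \<open>0\<close> itself is
  excluded since \<open>p\<close> may lie on a wall that has just been hit and erased.\<close>

definition next_collision ::
    "point \<Rightarrow> point \<Rightarrow> wall set \<Rightarrow> wall \<Rightarrow> real \<Rightarrow> bool" where
  "next_collision p v E w t \<longleftrightarrow>
     0 < t \<and> w \<notin> E \<and> p + t *\<^sub>R v \<in> wall_set w \<and>
     (\<forall>t'. 0 < t' \<and> t' \<le> t \<longrightarrow> p + t' *\<^sub>R v \<notin> corners) \<and>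
     (\<forall>t' w'. 0 < t' \<and> t' < t \<and> w' \<notin> E \<longrightarrow> p + t' *\<^sub>R v \<notin> wall_set w')"

definition initial_direction :: "real \<Rightarrow> point" where
  "initial_direction s = (1 / sqrt (1 + s\<^sup>2)) *\<^sub>R (1, s)"

text \<open>The particle started at \<open>P\<close> with slope \<open>s\<close> runs infinitely, and \<open>W 0, W 1, \<dots>\<close> are the walls
  it successively collides with; \<open>p n\<close> and \<open>v n\<close> are its position and velocity just after the
  first \<open>n\<close> collisions. An infinite sequence of collisions is the same as running forever without
  hitting a corner: as only finitely many walls are erased at each stage, a particle that does not
  hit a corner always collides again; and as every disc contains finitely many walls, each of
  which is hit at most once, infinitely many collisions take infinite time.\<close>

definition collision_sequence :: "point \<Rightarrow> real \<Rightarrow> (nat \<Rightarrow> wall) \<Rightarrow> bool" where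
  "collision_sequence P s W \<longleftrightarrow>
     (\<exists>(p :: nat \<Rightarrow> point) (v :: nat \<Rightarrow> point) (t :: nat \<Rightarrow> real).
        p 0 = P \<and> v 0 = initial_direction s \<and>
        (\<forall>n. next_collision (p n) (v n) (W ` {..<n}) (W n) (t n) \<and>
             p (Suc n) = p n + t n *\<^sub>R v n \<and>
             v (Suc n) = reflect (W n) (v n)))"

definition ray :: "point \<Rightarrow> point \<Rightarrow> point set" where
  "ray a u = {a + t *\<^sub>R u | t. 0 \<le> t}"

definition band :: "point \<Rightarrow> point \<Rightarrow> real \<Rightarrow> point set" where
  "band a u d = {x. \<exists>y \<in> ray a u. dist x y \<le> d}"

definition is_band :: "point set \<Rightarrow> bool" where
  "is_band b \<longleftrightarrow> (\<exists>a u d. u \<noteq> 0 \<and> 0 \<le> d \<and> b = band a u d)"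

text \<open>The absolute value of the slope of a ray defining the band (in particular, the ray is not
  vertical).\<close>

definition band_has_abs_slope :: "point set \<Rightarrow> real \<Rightarrow> bool" where
  "band_has_abs_slope b \<sigma> \<longleftrightarrow>
     (\<exists>a u d. fst u \<noteq> 0 \<and> 0 \<le> d \<and> b = band a u d \<and> \<sigma> = \<bar>snd u / fst u\<bar>)"

text \<open>Discs may be centred at the origin, because only the existence of a radius, or sufficiently
  large radii, matter.\<close>

definition outside_disc :: "real \<Rightarrow> wall \<Rightarrow> bool" where
  "outside_disc r w \<longleftrightarrow> wall_set w \<inter> cball 0 r = {}"

definition bands_cover :: "point set set \<Rightarrow> real \<Rightarrow> (nat \<Rightarrow> wall) \<Rightarrow> bool" where
  "bands_cover B r W \<longleftrightarrow>
     finite B \<and> (\<forall>b\<in>B. is_band b) \<and>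
     (\<forall>n. outside_disc r (W n) \<longrightarrow> wall_set (W n) \<subseteq> \<Union>B)"

definition tunnels :: "point \<Rightarrow> real \<Rightarrow> (nat \<Rightarrow> wall) \<Rightarrow> bool" where
  "tunnels P s W \<longleftrightarrow> collision_sequence P s W \<and> (\<exists>r B. bands_cover B r W)"

text \<open>All bands are required to have the slope \<open>\<sigma>\<close>: superfluous bands could always be added to
  the finite union, so looking at just one of them would not determine the slope.\<close>

definition tunnel_has_slope :: "(nat \<Rightarrow> wall) \<Rightarrow> real \<Rightarrow> bool" where
  "tunnel_has_slope W \<sigma> \<longleftrightarrow>
     (\<exists>r B. bands_cover B r W \<and> (\<forall>b\<in>B. band_has_abs_slope b \<sigma>))"

text \<open>For ``which band contains the wall'' to be meaningful, the bands must be disjoint outside the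
  disc; a wall outside the disc, being connected, then lies in exactly one of the (closed) bands.
  Without disjointness, finitely many overlapping parallel bands could encode the position of a
  wall across the tunnel, and the displacement would not be determined by the arm of the tunnel
  alone.\<close>

definition periodic_tunnel :: "(nat \<Rightarrow> wall) \<Rightarrow> bool" where
  "periodic_tunnel W \<longleftrightarrow>
     (\<exists>B. \<forall>\<^sub>F r in at_top.
        bands_cover B r W \<and>
        (\<forall>b\<in>B. \<forall>b'\<in>B. b \<noteq> b' \<longrightarrow> b \<inter> b' \<subseteq> cball 0 r) \<and>
        (\<exists>k>0. \<exists>displacement :: point set \<Rightarrow> int \<times> int.
           \<forall>n. outside_disc r (W n) \<longrightarrow>
             (is_Horizontal (W (n + k)) \<longleftrightarrow> is_Horizontal (W n)) \<and>
             (\<forall>b\<in>B. wall_set (W n) \<subseteq> b \<longrightarrow> base (W (n + k)) - base (W n) = displacement b)))"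

end

(*
Reflecting the grid instead of the particle turns the trajectory into a half-line of slope 3 + d,
and only the order in which it crosses the grid lines matters. Between two consecutive vertical
grid lines it crosses three horizontal ones, except that about once in 1/d times it crosses four.
As long as all gaps are 3, the particle repeats six collisions, displaced by (1, 1) each time (up to
a reflection of the grid). A gap of 4 makes it perform a detour, after which it digs on as before
but one unit further away from the diagonal. Whether the long gap falls on the first, second or third
gap of a core only permutes collisions near a corner. For d small in terms of P there are four
possible beginnings, according to the number of horizontal lines crossed before the first vertical
one. Counting cores and detours gives the slope. The pattern of long gaps is periodic for rational d;
conversely, a periodic tunnel has a rational proportion of vertical walls, which determines d
rationally. Corners are hit only for the countably many slopes for which the half-line meets a
lattice point.
*)
theory Submission
  imports Defs
begin

section \<open>The particle as an automaton\<close>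

text \<open>The erased set grows for ever, while a computation sees finitely many walls. The remedy
  is a moving window: \<open>height\<close> increases along the digging direction, and no block
  inspects a wall of height below -4 in its own frame. In that window only the last three cores have
  left traces, so the particle always meets the same surroundings. Since the automaton commutes with
  the isometries \<open>place c\<close>, one evaluation of each of four blocks and four beginnings
  covers every occurrence. The slope comes from counting: V columns contain m = \<delta> V + O(1)
  long gaps and k = (V - 20 m) / 3 + O(1) cores, which move the frame by (k + 4 m, k + 5 m), that
  is, by ((V - 8 m) / 3, (V - 5 m) / 3) + O(1). Hence the slope (1 - 5 \<delta>) / (1 - 8 \<delta>).
  Two conditions bound \<epsilon>: no second long gap may fall into the 20 gaps of a detour, and
  none into a beginning of up to 14 gaps.\<close>

text \<open>In the state \<open>(i, j, r, u)\<close> the particle is in the cell with lower left corner \<open>(i, j)\<close>, moving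
  right iff \<open>r\<close> and up iff \<open>u\<close>. The letter \<open>True\<close> stands for reaching a vertical grid line, \<open>False\<close>
  for reaching a horizontal one.\<close>

type_synonym cell = "int \<times> int \<times> bool \<times> bool"

fun crossed :: "bool \<Rightarrow> cell \<Rightarrow> wall" where
  "crossed True (i, j, r, u) = Vertical (if r then i + 1 else i, j)"
| "crossed False (i, j, r, u) = Horizontal (i, if u then j + 1 else j)"

fun pass :: "bool \<Rightarrow> cell \<Rightarrow> cell" where
  "pass True (i, j, r, u) = (if r then i + 1 else i - 1, j, r, u)"
| "pass False (i, j, r, u) = (i, if u then j + 1 else j - 1, r, u)"

fun bounce :: "bool \<Rightarrow> cell \<Rightarrow> cell" where
  "bounce True (i, j, r, u) = (i, j, \<not> r, u)"
| "bounce False (i, j, r, u) = (i, j, r, \<not> u)"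

fun run :: "bool list \<Rightarrow> cell \<Rightarrow> wall set \<Rightarrow> cell \<times> wall list" where
  "run [] c E = (c, [])"
| "run (l # ls) c E =
     (if crossed l c \<in> E then run ls (pass l c) E
      else case run ls (bounce l c) (insert (crossed l c) E) of
        (c', ws) \<Rightarrow> (c', crossed l c # ws))"

text \<open>Grows along the diagonal (1, 1) of a frame, so it measures how far ahead a wall
  lies.\<close>

fun height :: "wall \<Rightarrow> int" where
  "height (Horizontal (a, b)) = a + b"
| "height (Vertical (a, b)) = a + b"

text \<open>Erased walls that are merely inspected count as well as walls that are hit, because both
  answers steer the particle.\<close>

fun run_above :: "int \<Rightarrow> bool list \<Rightarrow> cell \<Rightarrow> wall set \<Rightarrow> bool" where
  "run_above m [] c E \<longleftrightarrow> True"
| "run_above m (l # ls) c E \<longleftrightarrow> m \<le> height (crossed l c) \<and>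
     (if crossed l c \<in> E then run_above m ls (pass l c) E
      else run_above m ls (bounce l c) (insert (crossed l c) E))"

text \<open>A state is also read as the isometry of the grid that takes \<open>(0, 0, True, True)\<close> to it.\<close>

fun place :: "cell \<Rightarrow> wall \<Rightarrow> wall" where
  "place (i, j, r, u) (Horizontal (a, b)) =
     Horizontal (if r then i + a else i - a, if u then j + b else j + 1 - b)"
| "place (i, j, r, u) (Vertical (a, b)) =
     Vertical (if r then i + a else i + 1 - a, if u then j + b else j - b)"

fun place_cell :: "cell \<Rightarrow> cell \<Rightarrow> cell" where
  "place_cell (i, j, r, u) (a, b, r', u') =
     (if r then i + a else i - a, if u then j + b else j - b, r = r', u = u')"

lemma inj_place: "inj (place c)"
proof (rule injI)
  fix v w assume "place c v = place c w"
  then show "v = w"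
    by (cases c; cases v; cases w) (auto split: if_splits)
qed

lemma crossed_place: "crossed l (place_cell f c) = place f (crossed l c)"
  by (cases l; cases f; cases c) auto

lemma pass_place: "pass l (place_cell f c) = place_cell f (pass l c)"
  by (cases l; cases f; cases c) auto

lemma bounce_place: "bounce l (place_cell f c) = place_cell f (bounce l c)"
  by (cases l; cases f; cases c) auto

lemma place_place_cell: "place (place_cell f g) w = place f (place g w)"
  by (cases f; cases g; cases w) auto

lemma place_cell_assoc: "place_cell (place_cell f g) h = place_cell f (place_cell g h)"
  by (cases f; cases g; cases h) auto

lemma height_place_translation [simp]:
  "height (place (a, b, True, True) w) = height w + a + b"
  by (cases w) auto

text \<open>A run depends on the erased set only through the walls it inspects, and the moves
  respect isometries of the grid. A wall erased on the way enters both sets, and injectivity of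
  \<open>place f\<close> keeps them in agreement.\<close>

lemma run_place:
  assumes "run_above m ls c E"
    and "\<And>w. m \<le> height w \<Longrightarrow> place f w \<in> E' \<longleftrightarrow> w \<in> E"
  shows "run ls (place_cell f c) E' = map_prod (place_cell f) (map (place f)) (run ls c E)"
  using assms
proof (induction ls arbitrary: c E E')
  case Nil
  then show ?case by simp
next
  case (Cons l ls)
  show ?case
  proof (cases "crossed l c \<in> E")
    case True
    then show ?thesis
      using Cons by (simp add: crossed_place pass_place)
  next
    case False
    have "run ls (place_cell f (bounce l c)) (insert (place f (crossed l c)) E') =
        map_prod (place_cell f) (map (place f)) (run ls (bounce l c) (insert (crossed l c) E))"
      by (rule Cons.IH) (use False Cons.prems in \<open>auto simp: inj_eq[OF inj_place]\<close>)
    then show ?thesis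
      using False Cons.prems by (simp add: crossed_place bounce_place split: prod.split)
  qed
qed

text \<open>The gaps are the numbers of horizontal grid lines crossed before each vertical one.\<close>

definition gap_word :: "nat list \<Rightarrow> bool list" where
  "gap_word gs = concat (map (\<lambda>g. replicate g False @ [True]) gs)"

definition core_walls :: "wall list" where
  "core_walls = [Horizontal (0, 1), Horizontal (0, 0), Vertical (1, 1), Horizontal (0, 2),
     Vertical (0, -1), Horizontal (0, -1)]"

text \<open>The walls erased by the three preceding core blocks; ahead of height \<open>-4\<close> these are the only
  erased walls that matter.\<close>

definition trail :: "wall list" where
  "trail = concat (map (\<lambda>k. map (place (k, k, True, True)) core_walls) [-1, -2, -3])"

text \<open>Three cores are enough in \<open>trail\<close>: the walls of a core have heights -1 to
  2, and each earlier core lies 2 lower, so the fourth last one reaches only height -6.\<close>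

definition settled :: "cell \<Rightarrow> wall set \<Rightarrow> bool" where
  "settled c E \<longleftrightarrow> (\<forall>w. -4 \<le> height w \<longrightarrow> (place c w \<in> E \<longleftrightarrow> w \<in> set trail))"

lemma settledD: "settled c E \<Longrightarrow> -4 \<le> height w \<Longrightarrow> place c w \<in> E \<longleftrightarrow> w \<in> set trail"
  by (simp add: settled_def)

text \<open>The height of the preimage of a wall under \<open>place c\<close>, spelled out so that
  it can be evaluated.\<close>

fun frame_height :: "cell \<Rightarrow> wall \<Rightarrow> int" where
  "frame_height (i, j, r, u) (Horizontal (a, b)) =
     (if r then a - i else i - a) + (if u then b - j else j + 1 - b)"
| "frame_height (i, j, r, u) (Vertical (a, b)) =
     (if r then a - i else i + 1 - a) + (if u then b - j else j - b)"

lemma frame_height_place [simp]: "frame_height c (place c w) = height w"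
  by (cases c; cases w) auto

text \<open>An executable substitute for \<open>settled\<close>, which quantifies over infinitely
  many walls.\<close>

definition settled_list :: "cell \<Rightarrow> wall list \<Rightarrow> bool" where
  "settled_list c ws \<longleftrightarrow>
     list_all (\<lambda>w. -4 \<le> frame_height c w \<longrightarrow> w \<in> set (map (place c) trail)) ws \<and>
     list_all (\<lambda>w. -4 \<le> height w \<longrightarrow> place c w \<in> set ws) trail"

lemma settled_list_imp_settled: "settled_list c ws \<Longrightarrow> settled c (set ws)"
  by (fastforce simp: settled_list_def settled_def list_all_iff dest: injD[OF inj_place])

text \<open>As \<open>0 \<le> a + b\<close>, every wall in the window of the new frame is in the
  window of the old one, where \<open>trail\<close> stands for all of \<open>E\<close>. What remains
  is a check on finite lists.\<close>

lemma settled_shift: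
  assumes E: "settled c E" and d: "d = (a, b, True, True)" "0 \<le> a + b"
    and ws: "settled_list d (trail @ ws)"
  shows "settled (place_cell c d) (E \<union> place c ` set ws)"
  unfolding settled_def
proof (intro allI impI)
  fix w assume w: "-4 \<le> height w"
  have "-4 \<le> height (place d w)"
    using w d by simp
  then have "place c (place d w) \<in> E \<union> place c ` set ws \<longleftrightarrow> place d w \<in> set (trail @ ws)"
    using settledD[OF E] by (auto simp: inj_image_mem_iff[OF inj_place])
  also have "\<dots> \<longleftrightarrow> w \<in> set trail"
    using settledD[OF settled_list_imp_settled[OF ws] w] .
  finally show "place (place_cell c d) w \<in> E \<union> place c ` set ws \<longleftrightarrow> w \<in> set trail"
    by (simp add: place_place_cell)
qed

definition origin :: cell where "origin = (0, 0, True, True)"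

lemma place_cell_origin [simp]: "place_cell f origin = f"
  by (cases f) (auto simp: origin_def)

text \<open>Block \<open>0\<close> is the core of the tunnel. In block \<open>t = 1, 2, 3\<close> the long gap occurs at position
  \<open>t - 1\<close> of a core; the detour that it causes, together with two cores that restore the trail, takes
  20 gaps.\<close>

definition block_gaps :: "nat \<Rightarrow> nat list" where
  "block_gaps t = (if t = 0 then [3, 3, 3] else (replicate 20 3)[t - 1 := 4])"

definition block_shift :: "nat \<Rightarrow> cell" where
  "block_shift t = (if t = 0 then (1, 1, True, True) else (4, 5, True, True))"

definition block_walls :: "nat \<Rightarrow> wall list" where
  "block_walls t = snd (run (gap_word (block_gaps t)) origin (set trail))"

text \<open>All facts obtained by simulating the blocks. The numbers of walls and of vertical walls
  serve the proof that irrational slopes are aperiodic.\<close>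

definition block_ok :: "nat \<Rightarrow> bool" where
  "block_ok t \<longleftrightarrow>
     run_above (-4) (gap_word (block_gaps t)) origin (set trail) \<and>
     fst (run (gap_word (block_gaps t)) origin (set trail)) = block_shift t \<and>
     length (block_walls t) = (if t = 0 then 6 else 32) \<and>
     length (filter is_Vertical (block_walls t)) = (if t = 0 then 2 else 12) \<and>
     settled_list (block_shift t) (trail @ block_walls t)"

lemma block_ok: "t < 4 \<Longrightarrow> block_ok t"
proof -
  have "block_ok 0" "block_ok 1" "block_ok 2" "block_ok 3"
    by code_simp+
  moreover assume "t < 4"
  then have "t = 0 \<or> t = 1 \<or> t = 2 \<or> t = 3"
    by auto
  ultimately show ?thesis
    by blast
qed

text \<open>The simulation at the origin, transported by \<open>run_place\<close> to any settled
  state. The second claim lets the next block follow.\<close>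

lemma run_block:
  assumes t: "t < 4" and E: "settled c E"
  shows "run (gap_word (block_gaps t)) c E =
      (place_cell c (block_shift t), map (place c) (block_walls t))"
    and "settled (place_cell c (block_shift t)) (E \<union> place c ` set (block_walls t))"
proof -
  note ok = block_ok[OF t, unfolded block_ok_def]
  have "run (gap_word (block_gaps t)) (place_cell c origin) E =
      map_prod (place_cell c) (map (place c)) (run (gap_word (block_gaps t)) origin (set trail))"
    by (rule run_place) (use ok settledD[OF E] in auto)
  then show "run (gap_word (block_gaps t)) c E =
      (place_cell c (block_shift t), map (place c) (block_walls t))"
    using ok by (auto simp: block_walls_def map_prod_def split: prod.splits)
  show "settled (place_cell c (block_shift t)) (E \<union> place c ` set (block_walls t))"
    by (rule settled_shift[OF E, where a = "if t = 0 then 1 else 4" and b = "if t = 0 then 1 else 5"])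
      (use ok in \<open>auto simp: block_shift_def\<close>)
qed

text \<open>The numbers of gaps after which a trajectory of slope slightly above 3 has settled, by the
  number \<open>g\<close> of horizontal grid lines crossed before the first vertical one; found by simulation.\<close>

definition start_gaps :: "nat \<Rightarrow> nat list" where
  "start_gaps g = g # replicate ([9, 13, 11, 8] ! g) 3"

lemma settled_start:
  assumes "g < 4"
  shows "case run (gap_word (start_gaps g)) origin {} of (c, ws) \<Rightarrow> settled c (set ws)"
proof -
  define ok where "ok g = (case run (gap_word (start_gaps g)) origin {} of
    (c, ws) \<Rightarrow> settled_list c ws)" for g
  have "ok 0" "ok 1" "ok 2" "ok 3"
    unfolding ok_def by code_simp+
  moreover have "g = 0 \<or> g = 1 \<or> g = 2 \<or> g = 3"
    using assms by auto
  ultimately have "ok g"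
    by blast
  then show ?thesis
    by (auto simp: ok_def intro: settled_list_imp_settled split: prod.splits)
qed

section \<open>Unfolding the trajectory\<close>

lemma mem_wall_set:
  "(x, y) \<in> wall_set (Horizontal (i, j)) \<longleftrightarrow> y = of_int j \<and> of_int i \<le> x \<and> x \<le> of_int i + 1"
  "(x, y) \<in> wall_set (Vertical (i, j)) \<longleftrightarrow> x = of_int i \<and> of_int j \<le> y \<and> y \<le> of_int j + 1"
proof -
  show "(x, y) \<in> wall_set (Horizontal (i, j)) \<longleftrightarrow> y = of_int j \<and> of_int i \<le> x \<and> x \<le> of_int i + 1"
    by (auto simp: closed_segment_def algebra_simps intro!: exI[of _ "x - of_int i"])
  show "(x, y) \<in> wall_set (Vertical (i, j)) \<longleftrightarrow> x = of_int i \<and> of_int j \<le> y \<and> y \<le> of_int j + 1"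
    by (auto simp: closed_segment_def algebra_simps intro!: exI[of _ "y - of_int j"])
qed

declare wall_set.simps [simp del]
declare mem_wall_set [simp]

lemma int_strictly_between: "\<not> (of_int a < (of_int b :: real) \<and> of_int b < (of_int a + 1 :: real))"
proof -
  have "(of_int b < (of_int a + 1 :: real)) = (of_int b < (of_int (a + 1) :: real))"
    by simp
  then show ?thesis
    by (simp only: of_int_less_iff) linarith
qed

lemma int_floor_unique:
  assumes "of_int a \<le> (y::real)" "y \<le> of_int a + 1" "of_int b < y" "y < of_int b + 1"
  shows "a = b"
proof -
  have "of_int a < (of_int (b + 1) :: real)" "of_int b < (of_int (a + 1) :: real)"
    using assms by auto
  then show ?thesis
    by (simp only: of_int_less_iff)
qed

lemma open_cell_disjoint:
  assumes "of_int i < x" "x < of_int i + 1" "of_int j < y" "y < of_int j + (1::real)"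
  shows "(x, y) \<notin> corners" and "(x, y) \<notin> wall_set w"
proof -
  have "x \<noteq> of_int a" "y \<noteq> of_int a" for a
    using assms int_strictly_between[of i a] int_strictly_between[of j a] by auto
  then show "(x, y) \<notin> corners" "(x, y) \<notin> wall_set w"
    by (auto simp: corners_def elim!: Ints_cases) (cases w; auto)
qed

lemma mem_wall_set_vertical_iff:
  assumes "of_int j < y" "y < of_int j + (1::real)"
  shows "(of_int i, y) \<in> wall_set w \<longleftrightarrow> w = Vertical (i, j)"
proof (cases w)
  case (Horizontal b)
  then show ?thesis
    using assms int_strictly_between[of j "snd b"] by (cases b) auto
next
  case (Vertical b)
  then show ?thesis
    using assms int_floor_unique[of "snd b" _ j] by (cases b) auto
qed

lemma mem_wall_set_horizontal_iff:
  assumes "of_int i < x" "x < of_int i + (1::real)"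
  shows "(x, of_int j) \<in> wall_set w \<longleftrightarrow> w = Horizontal (i, j)"
proof (cases w)
  case (Vertical b)
  then show ?thesis
    using assms int_strictly_between[of i "fst b"] by (cases b) auto
next
  case (Horizontal b)
  then show ?thesis
    using assms int_floor_unique[of "fst b" _ i] by (cases b) auto
qed

lemma mem_two_walls:
  assumes "p \<in> wall_set w" "p \<in> wall_set w'" "p \<notin> corners"
  shows "w = w'"
proof -
  obtain x y where p: "p = (x, y)"
    by (cases p)
  have ncx: "x \<notin> \<int> \<or> y \<notin> \<int>"
    using assms(3) p by (auto simp: corners_def)
  obtain b c where b: "w = Horizontal (b, c) \<or> w = Vertical (b, c)"
    by (cases w) auto
  show ?thesis
    using b
  proof
    assume w: "w = Horizontal (b, c)"
    then have y: "y = of_int c" "of_int b \<le> x" "x \<le> of_int b + 1"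
      using assms(1) p by auto
    then have "x \<noteq> of_int k" for k
      using ncx by auto
    from this[of b] this[of "b + 1"] y have "of_int b < x" "x < of_int b + 1"
      by auto
    then show ?thesis
      using mem_wall_set_horizontal_iff[of b x c] assms p y by auto
  next
    assume w: "w = Vertical (b, c)"
    then have y: "x = of_int b" "of_int c \<le> y" "y \<le> of_int c + 1"
      using assms(1) p by auto
    then have "y \<noteq> of_int k" for k
      using ncx by auto
    from this[of c] this[of "c + 1"] y have "of_int c < y" "y < of_int c + 1"
      by auto
    then show ?thesis
      using mem_wall_set_vertical_iff[of c y b] assms p y by auto
  qed
qed

lemma next_collision_unique:
  assumes "next_collision p v E w t" "next_collision p v E w' t'"
  shows "w = w'" "t = t'"
proof -
  show t: "t = t'"
    using assms unfolding next_collision_def by (metis linorder_neqE)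
  show "w = w'"
    using assms mem_two_walls unfolding next_collision_def t by blast
qed

text \<open>Determinism: claims about every tunnel from a given start reduce to the one sequence
  constructed below.\<close>

lemma collision_sequence_unique:
  assumes "collision_sequence P s W" "collision_sequence P s W'"
  shows "W = W'"
proof -
  obtain p v t where 1: "p 0 = P" "v 0 = initial_direction s"
    "\<And>n. next_collision (p n) (v n) (W ` {..<n}) (W n) (t n)"
    "\<And>n. p (Suc n) = p n + t n *\<^sub>R v n" "\<And>n. v (Suc n) = reflect (W n) (v n)"
    using assms(1) unfolding collision_sequence_def by metis
  obtain p' v' t' where 2: "p' 0 = P" "v' 0 = initial_direction s"
    "\<And>n. next_collision (p' n) (v' n) (W' ` {..<n}) (W' n) (t' n)"
    "\<And>n. p' (Suc n) = p' n + t' n *\<^sub>R v' n" "\<And>n. v' (Suc n) = reflect (W' n) (v' n)"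
    using assms(2) unfolding collision_sequence_def by metis
  have "p n = p' n \<and> v n = v' n \<and> (\<forall>m<n. W m = W' m)" for n
  proof (induction n)
    case 0
    then show ?case
      using 1 2 by simp
  next
    case (Suc n)
    then have "W ` {..<n} = W' ` {..<n}"
      by auto
    then have "W n = W' n" "t n = t' n"
      using 1(3)[of n] 2(3)[of n] Suc next_collision_unique by metis+
    then show ?case
      using Suc 1 2 by (auto simp: less_Suc_eq)
  qed
  then show ?thesis
    by (auto intro!: ext)
qed

section \<open>Unfolding an arbitrary collision sequence\<close>

definition speed :: "real \<Rightarrow> real" where
  "speed s = 1 / sqrt (1 + s\<^sup>2)"

lemma speed_pos: "0 < speed s"
  by (simp add: speed_def add_pos_nonneg)

lemma initial_direction_eq: "initial_direction s = (speed s, s * speed s)"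
  by (simp add: initial_direction_def speed_def)

text \<open>A reflection in the grid line at k turns a coordinate x into 2 k - x. So only signs and
  integer translations accumulate, and lattice points of the half-line correspond to corners on the
  path.\<close>

lemma collision_sequence_unfolding:
  assumes 1: "p 0 = (x0, y0)" "v 0 = initial_direction s"
    "\<And>n. p (Suc n) = p n + t n *\<^sub>R v n" "\<And>n. v (Suc n) = reflect (W n) (v n)"
    "\<And>n. p (Suc n) \<in> wall_set (W n)"
  defines "T \<equiv> \<lambda>n. \<Sum>i<n. t i"
  shows "\<exists>(\<sigma>::real) (\<tau>::real) (a::int) (b::int). \<bar>\<sigma>\<bar> = 1 \<and> \<bar>\<tau>\<bar> = 1 \<and>
    p n = (\<sigma> * (x0 + speed s * T n) + a, \<tau> * (y0 + s * speed s * T n) + b) \<and>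
    v n = (\<sigma> * speed s, \<tau> * (s * speed s))"
proof (induction n)
  case 0
  show ?case
    by (rule exI[of _ 1], rule exI[of _ 1], rule exI[of _ 0], rule exI[of _ 0])
      (simp add: 1 T_def initial_direction_eq)
next
  case (Suc n)
  then obtain \<sigma> \<tau> :: real and a b :: int where IH: "\<bar>\<sigma>\<bar> = 1" "\<bar>\<tau>\<bar> = 1"
    "p n = (\<sigma> * (x0 + speed s * T n) + a, \<tau> * (y0 + s * speed s * T n) + b)"
    "v n = (\<sigma> * speed s, \<tau> * (s * speed s))"
    by blast
  have p: "p (Suc n) = (\<sigma> * (x0 + speed s * T (Suc n)) + a, \<tau> * (y0 + s * speed s * T (Suc n)) + b)"
    using IH(3,4) by (simp add: 1(3) T_def algebra_simps)
  obtain i j where w: "W n = Horizontal (i, j) \<or> W n = Vertical (i, j)"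
    by (cases "W n") auto
  from w show ?case
  proof
    assume w: "W n = Horizontal (i, j)"
    then have "\<tau> * (y0 + s * speed s * T (Suc n)) + b = j"
      using 1(5)[of n] p by simp
    then have "p (Suc n) = (\<sigma> * (x0 + speed s * T (Suc n)) + a,
        (- \<tau>) * (y0 + s * speed s * T (Suc n)) + of_int (2 * j - b))"
      using p by simp
    moreover have "v (Suc n) = (\<sigma> * speed s, (- \<tau>) * (s * speed s))"
      using w by (simp add: 1 IH)
    moreover have "\<bar>- \<tau>\<bar> = 1"
      using IH by simp
    ultimately show ?case
      using IH(1) by blast
  next
    assume w: "W n = Vertical (i, j)"
    then have "\<sigma> * (x0 + speed s * T (Suc n)) + a = i"
      using 1(5)[of n] p by simp
    then have "p (Suc n) = ((- \<sigma>) * (x0 + speed s * T (Suc n)) + of_int (2 * i - a),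
        \<tau> * (y0 + s * speed s * T (Suc n)) + b)"
      using p by simp
    moreover have "v (Suc n) = ((- \<sigma>) * speed s, \<tau> * (s * speed s))"
      using w by (simp add: 1 IH)
    moreover have "\<bar>- \<sigma>\<bar> = 1"
      using IH by simp
    ultimately show ?case
      using IH(2) by blast
  qed
qed

lemma finite_affine_integer_times:
  assumes "(c::real) \<noteq> 0"
  shows "finite {\<tau> \<in> {a..b}. x + c * \<tau> \<in> \<int>}"
proof -
  have "bounded ((\<lambda>\<tau>. x + c * \<tau>) ` {a..b})"
    by (intro compact_imp_bounded compact_continuous_image continuous_intros) auto
  then obtain B where "\<forall>y \<in> (\<lambda>\<tau>. x + c * \<tau>) ` {a..b}. norm y \<le> B"
    unfolding bounded_iff by blast
  then have B: "\<bar>x + c * \<tau>\<bar> \<le> B" if "\<tau> \<in> {a..b}" for \<tau>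
    using that by auto
  have "(\<lambda>\<tau>. x + c * \<tau>) ` {\<tau> \<in> {a..b}. x + c * \<tau> \<in> \<int>} \<subseteq> {z \<in> \<int>. \<bar>z\<bar> \<le> B}"
    using B by auto
  then have "finite ((\<lambda>\<tau>. x + c * \<tau>) ` {\<tau> \<in> {a..b}. x + c * \<tau> \<in> \<int>})"
    using finite_abs_int_segment finite_subset by blast
  moreover have "inj_on (\<lambda>\<tau>. x + c * \<tau>) S" for S
    using assms by (auto simp: inj_on_def)
  ultimately show ?thesis
    using finite_imageD by blast
qed

text \<open>If the half-line meets a lattice point at time z, no flight can extend to z, as it would
  contain a corner. All collision times then lie below z; they are distinct and occur on grid lines,
  but the half-line crosses only finitely many of these before z.\<close>

lemma collision_sequence_avoids_lattice:
  assumes W: "collision_sequence (x0, y0) s W" and s: "0 < s" and "0 < x" 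
    and X: "x0 + x \<in> \<int>" and Y: "y0 + s * x \<in> \<int>"
  shows False
proof -
  obtain p v t where 1: "p 0 = (x0, y0)" "v 0 = initial_direction s"
    "\<And>n. next_collision (p n) (v n) (W ` {..<n}) (W n) (t n)"
    "\<And>n. p (Suc n) = p n + t n *\<^sub>R v n" "\<And>n. v (Suc n) = reflect (W n) (v n)"
    using W unfolding collision_sequence_def by metis
  define T where "T n = (\<Sum>i<n. t i)" for n
  have t: "0 < t n" and wall: "p (Suc n) \<in> wall_set (W n)"
    and nc: "\<And>t'. 0 < t' \<Longrightarrow> t' \<le> t n \<Longrightarrow> p n + t' *\<^sub>R v n \<notin> corners" for n
    using 1(3)[of n] 1(4)[of n] by (auto simp: next_collision_def)
  define c where "c = speed s"
  have c: "0 < c"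
    by (simp add: c_def speed_pos)
  have unfold: "\<exists>(\<sigma>::real) (\<tau>::real) (a::int) (b::int). \<bar>\<sigma>\<bar> = 1 \<and> \<bar>\<tau>\<bar> = 1 \<and>
    p n = (\<sigma> * (x0 + c * T n) + a, \<tau> * (y0 + s * c * T n) + b) \<and>
    v n = (\<sigma> * c, \<tau> * (s * c))" for n
    unfolding T_def c_def by (rule collision_sequence_unfolding[OF 1(1,2,4,5) wall])
  have mono: "strict_mono T"
    using t by (intro strict_mono_Suc_iff[THEN iffD2]) (simp add: T_def)
  have Ints_iff: "\<sigma> * z \<in> \<int> \<longleftrightarrow> z \<in> \<int>" if "\<bar>\<sigma>\<bar> = (1::real)" for \<sigma> z
  proof -
    have "\<sigma> = 1 \<or> \<sigma> = -1"
      using that by auto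
    then show ?thesis
      by (auto simp: minus_in_Ints_iff)
  qed
  define z where "z = x / c"
  have z: "0 < z" "c * z = x"
    using \<open>0 < x\<close> c by (auto simp: z_def)
  have bound: "T n < z" for n
  proof (induction n)
    case 0
    then show ?case
      using z by (simp add: T_def)
  next
    case (Suc n)
    show ?case
    proof (rule ccontr)
      assume "\<not> T (Suc n) < z"
      then have "0 < z - T n" "z - T n \<le> t n"
        using Suc by (auto simp: T_def)
      then have "p n + (z - T n) *\<^sub>R v n \<notin> corners"
        by (rule nc)
      moreover obtain \<sigma> \<tau> :: real and a b :: int where u: "\<bar>\<sigma>\<bar> = 1" "\<bar>\<tau>\<bar> = 1"
        "p n = (\<sigma> * (x0 + c * T n) + a, \<tau> * (y0 + s * c * T n) + b)" "v n = (\<sigma> * c, \<tau> * (s * c))"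
        using unfold by blast
      have eq: "p n + (z - T n) *\<^sub>R v n = (\<sigma> * (x0 + c * z) + a, \<tau> * (y0 + s * (c * z)) + b)"
        by (simp add: u algebra_simps)
      have "p n + (z - T n) *\<^sub>R v n \<in> corners"
        unfolding eq using X Y u by (simp add: corners_def Ints_iff z)
      ultimately show False
        by blast
    qed
  qed
  have "T (Suc n) \<in> {\<tau> \<in> {0..z}. x0 + c * \<tau> \<in> \<int>} \<union> {\<tau> \<in> {0..z}. y0 + (s * c) * \<tau> \<in> \<int>}" for n
  proof -
    obtain \<sigma> \<tau> :: real and a b :: int where u: "\<bar>\<sigma>\<bar> = 1" "\<bar>\<tau>\<bar> = 1"
      "p (Suc n) = (\<sigma> * (x0 + c * T (Suc n)) + a, \<tau> * (y0 + s * c * T (Suc n)) + b)"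
      using unfold by blast
    have "fst (p (Suc n)) \<in> \<int> \<or> snd (p (Suc n)) \<in> \<int>"
      using wall[of n] by (cases "W n"; cases "p (Suc n)") auto
    then have "x0 + c * T (Suc n) \<in> \<int> \<or> y0 + s * c * T (Suc n) \<in> \<int>"
      using u by (simp add: Ints_iff)
    moreover have "0 \<le> T (Suc n)"
      unfolding T_def using t by (intro sum_nonneg) (simp add: less_imp_le)
    ultimately show ?thesis
      using bound[of "Suc n"] by auto
  qed
  then have "range (\<lambda>n. T (Suc n)) \<subseteq>
      {\<tau> \<in> {0..z}. x0 + c * \<tau> \<in> \<int>} \<union> {\<tau> \<in> {0..z}. y0 + (s * c) * \<tau> \<in> \<int>}"
    by blast
  then have "finite (range (\<lambda>n. T (Suc n)))"
    by (rule finite_subset) (use c s in \<open>intro finite_UnI finite_affine_integer_times; simp\<close>)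
  moreover have "inj (\<lambda>n. T (Suc n))"
    by (rule injI) (simp add: strict_mono_eq[OF mono])
  ultimately show False
    using finite_imageD by blast
qed

text \<open>Reflecting the grid rather than the particle, the trajectory becomes the half-line from
  \<open>(x0, y0)\<close> with slope \<open>s\<close>. After \<open>h\<close> horizontal and \<open>v\<close> vertical grid lines have been crossed by
  the half-line, it is in the cell with lower left corner \<open>(v, h)\<close>.\<close>

locale trajectory =
  fixes x0 y0 s :: real
  assumes x0: "0 < x0" "x0 < 1" and y0: "0 < y0" "y0 < 1" and s: "0 < s"
    and avoid: "\<And>v h::nat. (real v + 1 - x0) * s \<noteq> real h + 1 - y0"
begin

text \<open>At the next vertical line the half-line is still below the next horizontal one.
  Equality, a lattice point, is excluded by \<open>avoid\<close>.\<close>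

definition vertical_next :: "nat \<times> nat \<Rightarrow> bool" where
  "vertical_next hv \<longleftrightarrow> (real (snd hv) + 1 - x0) * s < real (fst hv) + 1 - y0"

primrec counts :: "nat \<Rightarrow> nat \<times> nat" where
  "counts 0 = (0, 0)"
| "counts (Suc e) = (if vertical_next (counts e) then (fst (counts e), Suc (snd (counts e)))
     else (Suc (fst (counts e)), snd (counts e)))"

abbreviation hc :: "nat \<Rightarrow> nat" where "hc e \<equiv> fst (counts e)"
abbreviation vc :: "nat \<Rightarrow> nat" where "vc e \<equiv> snd (counts e)"
abbreviation letter :: "nat \<Rightarrow> bool" where "letter e \<equiv> vertical_next (counts e)"

text \<open>An event is a crossing of a grid line by the half-line, whether the particle passes
  there or bounces. The hits form a list because their order is the collision sequence.\<close>

primrec conf :: "nat \<Rightarrow> cell \<times> wall list" where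
  "conf 0 = (origin, [])"
| "conf (Suc e) = (let (c, H) = conf e; w = crossed (letter e) c in
     if w \<in> set H then (pass (letter e) c, H) else (bounce (letter e) c, H @ [w]))"

abbreviation cell :: "nat \<Rightarrow> cell" where "cell e \<equiv> fst (conf e)"
abbreviation hits :: "nat \<Rightarrow> wall list" where "hits e \<equiv> snd (conf e)"

lemma conf_pass:
  "crossed (letter e) (cell e) \<in> set (hits e) \<Longrightarrow>
    conf (Suc e) = (pass (letter e) (cell e), hits e)"
  by (cases "conf e") (simp add: Let_def)

lemma conf_bounce:
  "crossed (letter e) (cell e) \<notin> set (hits e) \<Longrightarrow>
    conf (Suc e) = (bounce (letter e) (cell e), hits e @ [crossed (letter e) (cell e)])"
  by (cases "conf e") (simp add: Let_def)

declare conf.simps(2) [simp del]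

lemma conf_run:
  assumes "map letter [e..<e + length ls] = ls"
  shows "conf (e + length ls) =
    (fst (run ls (cell e) (set (hits e))), hits e @ snd (run ls (cell e) (set (hits e))))"
  using assms
proof (induction ls arbitrary: e)
  case Nil
  then show ?case by simp
next
  case (Cons l ls)
  have "map letter [e..<e + length (l # ls)] = letter e # map letter [Suc e..<Suc e + length ls]"
    by (simp add: upt_conv_Cons del: upt_Suc)
  then have l: "letter e = l" and ls: "map letter [Suc e..<Suc e + length ls] = ls"
    using Cons.prems by auto
  note IH = Cons.IH[OF ls]
  show ?case
  proof (cases "crossed l (cell e) \<in> set (hits e)")
    case True
    then show ?thesis
      using IH l by (simp add: conf_pass)
  next
    case False
    then show ?thesis
      using IH l by (simp add: conf_bounce split: prod.split)
  qed
qed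

abbreviation c where "c \<equiv> speed s"

definition X :: "real \<Rightarrow> real" where "X \<tau> = x0 + c * \<tau>"
definition Y :: "real \<Rightarrow> real" where "Y \<tau> = y0 + s * c * \<tau>"

primrec time :: "nat \<Rightarrow> real" where
  "time 0 = 0"
| "time (Suc e) = (if letter e then (real (vc e) + 1 - x0) / c else (real (hc e) + 1 - y0) / (s * c))"

fun coord :: "int \<Rightarrow> bool \<Rightarrow> real \<Rightarrow> real" where
  "coord i r x = (if r then of_int i + x else of_int i + 1 - x)"

text \<open>The half-line folded back by the isometry of state \<open>e\<close>, taken at all times
  and not only between two events. Thus passing through an erased wall does not change the function
  \<open>pos e\<close>, and bouncing changes it only by a reflection.\<close>

definition pos :: "nat \<Rightarrow> real \<Rightarrow> point" where
  "pos e \<tau> = (case cell e of (i, j, r, u) \<Rightarrow>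
     (coord i r (X \<tau> - real (vc e)), coord j u (Y \<tau> - real (hc e))))"

definition vel :: "nat \<Rightarrow> point" where
  "vel e = (case cell e of (i, j, r, u) \<Rightarrow> (if r then c else - c, if u then s * c else - (s * c)))"

lemma X_mono: "\<tau> < \<tau>' \<Longrightarrow> X \<tau> < X \<tau>'"
  using speed_pos by (simp add: X_def)

lemma Y_mono: "\<tau> < \<tau>' \<Longrightarrow> Y \<tau> < Y \<tau>'"
  using speed_pos s by (simp add: Y_def)

lemma X_time: "letter e \<Longrightarrow> X (time (Suc e)) = real (vc e) + 1"
  using speed_pos[of s] by (simp add: X_def)

lemma Y_time: "\<not> letter e \<Longrightarrow> Y (time (Suc e)) = real (hc e) + 1"
  using speed_pos[of s] s by (simp add: Y_def)

lemma Y_time_less: "letter e \<Longrightarrow> Y (time (Suc e)) < real (hc e) + 1"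
  using speed_pos[of s] s by (simp add: Y_def vertical_next_def) (simp add: algebra_simps)

lemma X_time_less:
  assumes "\<not> letter e"
  shows "X (time (Suc e)) < real (vc e) + 1"
proof -
  have "real (hc e) + 1 - y0 < (real (vc e) + 1 - x0) * s"
    using assms avoid[of "vc e" "hc e"] by (simp add: vertical_next_def)
  then have "(real (hc e) + 1 - y0) / s < real (vc e) + 1 - x0"
    using s by (simp add: field_simps)
  then show ?thesis
    using assms speed_pos[of s] by (simp add: X_def)
qed

text \<open>Between events \<open>e\<close> and \<open>Suc e\<close> the half-line runs inside the
  cell given by the counts. The lower bounds are weak because at an event it lies on a side of that
  cell.\<close>

lemma time_invariant:
  "real (vc e) \<le> X (time e) \<and> X (time e) < real (vc e) + 1 \<and>
   real (hc e) \<le> Y (time e) \<and> Y (time e) < real (hc e) + 1 \<and> time e < time (Suc e)"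
proof -
  have step: "time e < time (Suc e)"
    if "X (time e) < real (vc e) + 1" "Y (time e) < real (hc e) + 1" for e
  proof (cases "letter e")
    case True
    then have "X (time e) < X (time (Suc e))"
      using that X_time[of e] by simp
    then show ?thesis
      using X_mono[of "time (Suc e)" "time e"] by (metis linorder_neqE_linordered_idom order_less_asym)
  next
    case False
    then have "Y (time e) < Y (time (Suc e))"
      using that Y_time[of e] by simp
    then show ?thesis
      using Y_mono[of "time (Suc e)" "time e"] by (metis linorder_neqE_linordered_idom order_less_asym)
  qed
  show ?thesis
  proof (induction e)
    case 0
    then show ?case
      using x0 y0 step[of 0] by (simp add: X_def Y_def del: time.simps(2))
  next
    case (Suc e)
    have "X (time e) < X (time (Suc e))" "Y (time e) < Y (time (Suc e))"
      using Suc by (auto intro: X_mono Y_mono simp del: time.simps(2))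
    then show ?case
      using Suc step[of "Suc e"] X_time[of e] Y_time[of e] X_time_less[of e] Y_time_less[of e]
      by (cases "letter e") (auto simp del: time.simps(2))
  qed
qed

declare time.simps(2) [simp del]

lemma time_less: "time e < time (Suc e)"
  using time_invariant by blast

lemma time_mono: "e \<le> e' \<Longrightarrow> time e \<le> time e'"
  by (rule lift_Suc_mono_le[of time]) (simp_all add: time_less less_imp_le)

lemma pos_affine: "pos e \<tau>' = pos e \<tau> + (\<tau>' - \<tau>) *\<^sub>R vel e"
  by (simp add: pos_def vel_def X_def Y_def algebra_simps split: prod.split)

lemma between_events:
  assumes "time e < \<tau>" "\<tau> < time (Suc e)"
  shows "pos e \<tau> \<notin> corners" and "pos e \<tau> \<notin> wall_set w"
proof -
  obtain i j r u where cell: "cell e = (i, j, r, u)"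
    by (metis prod_cases4)
  have "X (time e) < X \<tau>" "Y (time e) < Y \<tau>" "X \<tau> < X (time (Suc e))" "Y \<tau> < Y (time (Suc e))"
    using assms by (auto intro: X_mono Y_mono)
  then have "real (vc e) < X \<tau>" "X \<tau> < real (vc e) + 1" "real (hc e) < Y \<tau>" "Y \<tau> < real (hc e) + 1"
    using time_invariant[of e] X_time[of e] Y_time[of e] X_time_less[of e] Y_time_less[of e]
    by linarith+
  then have "of_int i < fst (pos e \<tau>)" "fst (pos e \<tau>) < of_int i + 1"
    "of_int j < snd (pos e \<tau>)" "snd (pos e \<tau>) < of_int j + 1"
    by (auto simp: pos_def cell)
  from open_cell_disjoint[OF this] show "pos e \<tau> \<notin> corners" "pos e \<tau> \<notin> wall_set w"
    by simp_all
qed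

lemma at_event:
  shows "pos e (time (Suc e)) \<notin> corners"
    and "pos e (time (Suc e)) \<in> wall_set w \<longleftrightarrow> w = crossed (letter e) (cell e)"
proof -
  obtain i j r u where cell: "cell e = (i, j, r, u)"
    by (metis prod_cases4)
  have less: "X (time e) < X (time (Suc e))" "Y (time e) < Y (time (Suc e))"
    using time_less by (auto intro: X_mono Y_mono)
  have "pos e (time (Suc e)) \<notin> corners \<and>
    (pos e (time (Suc e)) \<in> wall_set w \<longleftrightarrow> w = crossed (letter e) (cell e))"
  proof (cases "letter e")
    case True
    define y where "y = coord j u (Y (time (Suc e)) - real (hc e))"
    have "of_int j < y" "y < of_int j + 1"
      using True less time_invariant[of e] Y_time_less[of e] by (auto simp: y_def)
    moreover have "pos e (time (Suc e)) = (of_int (if r then i + 1 else i), y)"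
      using True X_time[of e] by (simp add: pos_def cell y_def)
    ultimately show ?thesis
      using True mem_wall_set_vertical_iff[of j y] int_strictly_between[of j]
      by (auto simp: cell corners_def elim!: Ints_cases)
  next
    case False
    define x where "x = coord i r (X (time (Suc e)) - real (vc e))"
    have "of_int i < x" "x < of_int i + 1"
      using False less time_invariant[of e] X_time_less[of e] by (auto simp: x_def)
    moreover have "pos e (time (Suc e)) = (x, of_int (if u then j + 1 else j))"
      using False Y_time[of e] by (simp add: pos_def cell x_def)
    ultimately show ?thesis
      using False mem_wall_set_horizontal_iff[of i x] int_strictly_between[of i]
      by (auto simp: cell corners_def elim!: Ints_cases)
  qed
  then show "pos e (time (Suc e)) \<notin> corners"
    "pos e (time (Suc e)) \<in> wall_set w \<longleftrightarrow> w = crossed (letter e) (cell e)"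
    by auto
qed

lemma pass_event:
  assumes "crossed (letter e) (cell e) \<in> set (hits e)"
  shows "pos (Suc e) = pos e" and "vel (Suc e) = vel e"
  using conf_pass[OF assms]
  by (cases "letter e"; cases "cell e"; auto simp: pos_def vel_def fun_eq_iff)+

lemma bounce_event:
  assumes "crossed (letter e) (cell e) \<notin> set (hits e)"
  shows "pos (Suc e) (time (Suc e)) = pos e (time (Suc e))"
    and "vel (Suc e) = reflect (crossed (letter e) (cell e)) (vel e)"
  using conf_bounce[OF assms] X_time[of e] Y_time[of e]
  by (cases "letter e"; cases "cell e"; auto simp: pos_def vel_def)+

definition clear :: "nat \<Rightarrow> real \<Rightarrow> bool" where
  "clear e \<tau> \<longleftrightarrow> pos e \<tau> \<notin> corners \<and> (\<forall>w. w \<notin> set (hits e) \<longrightarrow> pos e \<tau> \<notin> wall_set w)"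

text \<open>Events without a new hit are passes, so they leave the affine function
  \<open>pos\<close> alone: a stretch of such events is one straight flight.\<close>

lemma free_flight:
  assumes "a \<le> e" and "\<And>k. a \<le> k \<Longrightarrow> k \<le> e \<Longrightarrow> hits k = hits a"
  shows "pos e = pos a \<and> vel e = vel a \<and> (\<forall>\<tau>. time a < \<tau> \<and> \<tau> \<le> time e \<longrightarrow> clear a \<tau>)"
  using assms
proof (induction e rule: dec_induct)
  case base
  then show ?case by auto
next
  case (step e)
  have "hits k = hits a" if "a \<le> k" "k \<le> e" for k
    by (rule step.prems) (use that in simp_all)
  from step.IH[OF this]
  have IH: "pos e = pos a" "vel e = vel a" "\<And>\<tau>. time a < \<tau> \<Longrightarrow> \<tau> \<le> time e \<Longrightarrow> clear a \<tau>"
    by blast+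
  have hits: "hits e = hits a" "hits (Suc e) = hits a"
    by (rule step.prems; use step.hyps in simp)+
  have in_hits: "crossed (letter e) (cell e) \<in> set (hits e)"
    using conf_bounce[of e] hits by (intro ccontr[of "_ \<in> _"]) simp
  have "clear a \<tau>" if \<tau>: "time a < \<tau>" "\<tau> \<le> time (Suc e)" for \<tau>
  proof -
    consider "\<tau> \<le> time e" | "time e < \<tau>" "\<tau> < time (Suc e)" | "\<tau> = time (Suc e)"
      using \<tau> by linarith
    then show ?thesis
    proof cases
      case 1
      then show ?thesis using IH \<tau> by blast
    next
      case 2
      then show ?thesis
        using between_events[of e \<tau>] IH by (simp add: clear_def)
    next
      case 3
      then show ?thesis
        using at_event[of e] IH in_hits hits by (auto simp: clear_def)
    qed
  qed
  then show ?case
    using pass_event[OF in_hits] IH by simp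
qed

lemma length_hits_Suc: "length (hits (Suc e)) \<le> Suc (length (hits e))"
  "length (hits e) \<le> length (hits (Suc e))"
  using conf_pass[of e] conf_bounce[of e]
  by (cases "crossed (letter e) (cell e) \<in> set (hits e)"; simp)+

lemma hits_prefix: "e \<le> e' \<Longrightarrow> \<exists>ws. hits e' = hits e @ ws"
proof (induction e' rule: dec_induct)
  case base
  then show ?case by simp
next
  case (step e')
  then show ?case
    using conf_pass[of e'] conf_bounce[of e']
    by (cases "crossed (letter e') (cell e') \<in> set (hits e')"; fastforce)
qed

lemma length_hits_mono: "e \<le> e' \<Longrightarrow> length (hits e) \<le> length (hits e')"
  using hits_prefix[of e e'] by auto

lemma hits_eqI: "e \<le> e' \<Longrightarrow> length (hits e) = length (hits e') \<Longrightarrow> hits e' = hits e"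
  using hits_prefix[of e e'] by auto

lemma nth_hits: "e \<le> e' \<Longrightarrow> n < length (hits e) \<Longrightarrow> hits e' ! n = hits e ! n"
  using hits_prefix[of e e'] by (auto simp: nth_append)

text \<open>The event that appends the entry with index \<open>n\<close> to the hits. It exists
  under the assumption \<open>unbounded\<close>, which \<open>unbounded_hits\<close> discharges
  later.\<close>

definition hit_event :: "nat \<Rightarrow> nat" where
  "hit_event n = (LEAST e. n < length (hits (Suc e)))"

definition walls :: "nat \<Rightarrow> wall" where
  "walls n = hits (Suc (hit_event n)) ! n"

context
  assumes unbounded: "\<And>n. \<exists>e. n < length (hits e)"
begin

lemma length_hits_hit_event:
  "length (hits (hit_event n)) = n" "length (hits (Suc (hit_event n))) = Suc n"
proof -
  obtain e where "n < length (hits e)"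
    using unbounded by blast
  then have "n < length (hits (Suc e))"
    using length_hits_Suc(2)[of e] by simp
  then have *: "n < length (hits (Suc (hit_event n)))"
    unfolding hit_event_def by (rule LeastI)
  have "length (hits (hit_event n)) \<le> n"
  proof (cases "hit_event n")
    case (Suc e)
    then have "\<not> n < length (hits (Suc e))"
      using not_less_Least[of e "\<lambda>e. n < length (hits (Suc e))"] by (simp add: hit_event_def)
    then show ?thesis
      using Suc by simp
  qed simp
  then show "length (hits (hit_event n)) = n" "length (hits (Suc (hit_event n))) = Suc n"
    using * length_hits_Suc(1)[of "hit_event n"] by auto
qed

lemma hits_eq_walls: "hits e = map walls [0..<length (hits e)]"
proof (rule nth_equalityI)
  fix n assume "n < length (hits e)"
  then show "hits e ! n = map walls [0..<length (hits e)] ! n"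
    using nth_hits[of e "Suc (hit_event n)" n] nth_hits[of "Suc (hit_event n)" e n]
      length_hits_hit_event(2)[of n] by (cases "e \<le> Suc (hit_event n)") (auto simp: walls_def)
qed simp

definition start_event :: "nat \<Rightarrow> nat" where
  "start_event n = (case n of 0 \<Rightarrow> 0 | Suc m \<Rightarrow> Suc (hit_event m))"

lemma length_hits_start_event: "length (hits (start_event n)) = n"
  by (cases n) (simp_all add: start_event_def length_hits_hit_event)

lemma start_le_hit_event: "start_event n \<le> hit_event n"
proof (rule ccontr)
  assume "\<not> start_event n \<le> hit_event n"
  then have "Suc (hit_event n) \<le> start_event n"
    by simp
  from length_hits_mono[OF this] show False
    by (simp add: length_hits_start_event length_hits_hit_event)
qed

lemma collision_sequence_walls: "collision_sequence (x0, y0) s walls"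
proof -
  define p where "p n = pos (start_event n) (time (start_event n))" for n
  define v where "v n = vel (start_event n)" for n
  define t where "t n = time (Suc (hit_event n)) - time (start_event n)" for n
  have "next_collision (p n) (v n) (walls ` {..<n}) (walls n) (t n) \<and>
      p (Suc n) = p n + t n *\<^sub>R v n \<and> v (Suc n) = reflect (walls n) (v n)" for n
  proof -
    \<comment> \<open>Flight \<open>n\<close> begins in state \<open>a\<close> and ends with the hit
      at event \<open>e\<close>; all events before \<open>e\<close> in this range are
      passes.\<close>
    define a e where "a = start_event n" and "e = hit_event n"
    have ae: "a \<le> e"
      using start_le_hit_event by (simp add: a_def e_def)
    have len: "length (hits a) = n" "length (hits e) = n" "length (hits (Suc e)) = Suc n"
      by (simp_all add: a_def e_def length_hits_start_event length_hits_hit_event)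
    have hits: "hits k = hits a" if "a \<le> k" "k \<le> e" for k
      using that len length_hits_mono[of a k] length_hits_mono[of k e] by (intro hits_eqI) auto
    have flight: "pos e = pos a" "vel e = vel a" "\<And>\<tau>. time a < \<tau> \<Longrightarrow> \<tau> \<le> time e \<Longrightarrow> clear a \<tau>"
      using free_flight[OF ae hits] by auto
    have E: "walls ` {..<n} = set (hits a)"
      by (subst hits_eq_walls) (simp add: len lessThan_atLeast0)
    define w where "w = crossed (letter e) (cell e)"
    have w: "w \<notin> set (hits e)"
      using conf_pass[of e] len by (auto simp: w_def)
    have walls: "walls n = w"
      using conf_bounce[of e] w len by (simp add: walls_def nth_append flip: e_def w_def)
    have pos: "p n + t' *\<^sub>R v n = pos a (time a + t')" for t'
      using pos_affine[of a "time a + t'" "time a"] by (simp add: p_def v_def a_def)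
    have t: "time a + t n = time (Suc e)"
      by (simp add: t_def a_def e_def)
    have clear: "clear a \<tau>" if "time a < \<tau>" "\<tau> < time (Suc e)" for \<tau>
      using that flight between_events[of e \<tau>] by (cases "\<tau> \<le> time e") (auto simp: clear_def)
    have "0 < t n"
      using time_mono[OF ae] time_less[of e] t by simp
    moreover have "walls n \<notin> walls ` {..<n}"
      using w walls E hits[OF ae] by simp
    moreover have "p n + t n *\<^sub>R v n \<in> wall_set (walls n)"
      using at_event(2)[of e w] by (simp add: pos t walls flight w_def)
    moreover have "p n + t' *\<^sub>R v n \<notin> corners" if "0 < t' \<and> t' \<le> t n" for t'
      using that t clear[of "time a + t'"] at_event(1)[of e] flight
      by (cases "t' = t n") (auto simp: pos clear_def)
    moreover have "p n + t' *\<^sub>R v n \<notin> wall_set w'"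
      if "0 < t' \<and> t' < t n \<and> w' \<notin> walls ` {..<n}" for t' w'
      using that t clear[of "time a + t'"] E by (auto simp: pos clear_def)
    ultimately have "next_collision (p n) (v n) (walls ` {..<n}) (walls n) (t n)"
      by (simp add: next_collision_def)
    moreover have "p (Suc n) = p n + t n *\<^sub>R v n"
      using bounce_event(1)[of e] w flight
      by (simp add: pos t) (simp add: p_def start_event_def w_def flip: e_def)
    moreover have "v (Suc n) = reflect (walls n) (v n)"
    proof -
      have "v (Suc n) = vel (Suc e)" "v n = vel a"
        by (simp_all add: v_def start_event_def a_def e_def)
      then show ?thesis
        using bounce_event(2)[of e] w flight walls by (simp add: w_def)
    qed
    ultimately show ?thesis
      by blast
  qed
  moreover have "p 0 = (x0, y0)" "v 0 = initial_direction s"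
    by (simp_all add: p_def v_def start_event_def pos_def vel_def X_def Y_def origin_def
        initial_direction_eq)
  ultimately show ?thesis
    unfolding collision_sequence_def by blast
qed

end

end

section \<open>Slopes slightly above 3\<close>

lemma gap_word_simps [simp]:
  "gap_word [] = []" "gap_word (g # gs) = replicate g False @ True # gap_word gs"
  by (simp_all add: gap_word_def)

lemma is_Vertical_place [simp]: "is_Vertical (place c w) = is_Vertical w"
  by (cases c; cases w) auto

lemma block_walls_lengths:
  assumes "t < 4"
  shows "length (block_walls t) = (if t = 0 then 6 else 32)"
    and "length (filter is_Vertical (block_walls t)) = (if t = 0 then 2 else 12)"
  using block_ok[OF assms] by (auto simp: block_ok_def)

text \<open>The bound with 20 leaves at most one long gap in the 20 gaps of a detour. The bound with
  14, the largest length of a list \<open>start_gaps g\<close> for g < 4, keeps long gaps out of the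
  beginning.\<close>

locale steep_trajectory = trajectory +
  fixes \<delta> :: real
  assumes s_eq: "s = 3 + \<delta>" and \<delta>: "0 \<le> \<delta>" "20 * \<delta> < 1"
    and start: "frac (y0 - 3 * x0) + 14 * \<delta> < 1"
begin

text \<open>The height of the half-line at abscissa v, minus 3 v. It grows by \<delta> per column,
  and a gap is long exactly when its floor jumps.\<close>

definition z :: "nat \<Rightarrow> real" where
  "z v = y0 - 3 * x0 + \<delta> * (real v - x0)"

definition rows :: "nat \<Rightarrow> nat" where
  "rows v = (if v = 0 then 0 else nat (3 * int v + \<lfloor>z v\<rfloor>))"

lemma z_eq: "3 * real v + z v = y0 + (real v - x0) * s"
  by (simp add: z_def s_eq algebra_simps)

lemma z_diff: "z w - z v = \<delta> * (real w - real v)"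
  by (simp add: z_def algebra_simps)

lemma rows_eq: "0 < v \<Longrightarrow> int (rows v) = 3 * int v + \<lfloor>z v\<rfloor>"
proof -
  assume "0 < v"
  then have "0 \<le> (real v - x0) * s"
    using x0 s by (intro mult_nonneg_nonneg) auto
  then have "0 \<le> 3 * real v + z v"
    using y0 by (simp add: z_eq)
  then have "- 3 * int v \<le> \<lfloor>z v\<rfloor>"
    by (simp add: le_floor_iff)
  then show "int (rows v) = 3 * int v + \<lfloor>z v\<rfloor>"
    using \<open>0 < v\<close> by (simp add: rows_def)
qed

lemma vertical_next_iff: "vertical_next (h, v) \<longleftrightarrow> rows (Suc v) \<le> h"
proof -
  have "vertical_next (h, v) \<longleftrightarrow> 3 * real (Suc v) + z (Suc v) < real h + 1"
    by (simp only: z_eq) (auto simp: vertical_next_def algebra_simps)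
  also have "\<dots> \<longleftrightarrow> z (Suc v) < of_int (int h + 1 - 3 * int (Suc v))"
    by auto
  also have "\<dots> \<longleftrightarrow> \<lfloor>z (Suc v)\<rfloor> < int h + 1 - 3 * int (Suc v)"
    by (simp only: floor_less_iff)
  also have "\<dots> \<longleftrightarrow> int (rows (Suc v)) \<le> int h"
    by (subst rows_eq) auto
  finally show ?thesis
    by simp
qed

declare counts.simps(2) [simp del]

lemma counts_row:
  assumes "counts e = (h, v)" "h + g = rows (Suc v)"
  shows "map letter [e..<e + Suc g] = replicate g False @ [True] \<and>
    counts (e + Suc g) = (rows (Suc v), Suc v)"
  using assms
proof (induction g arbitrary: e h)
  case 0
  then show ?case
    by (simp add: vertical_next_iff counts.simps(2))
next
  case (Suc g)
  then have "\<not> letter e"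
    by (simp add: vertical_next_iff)
  then have "counts (Suc e) = (Suc h, v)"
    using Suc by (simp add: counts.simps(2))
  from Suc.IH[OF this] Suc.prems
  have "map letter [Suc e..<Suc e + Suc g] = replicate g False @ [True]"
    "counts (Suc e + Suc g) = (rows (Suc v), Suc v)"
    by simp_all
  then show ?case
    using \<open>\<not> letter e\<close> by (simp add: upt_conv_Cons del: upt_Suc)
qed

lemma counts_word:
  assumes "counts e = (rows v, v)" "\<And>i. i < length gs \<Longrightarrow> rows (v + i) + gs ! i = rows (v + i + 1)"
  shows "map letter [e..<e + length (gap_word gs)] = gap_word gs \<and>
    counts (e + length (gap_word gs)) = (rows (v + length gs), v + length gs)"
  using assms
proof (induction gs arbitrary: e v)
  case Nil
  then show ?case by simp
next
  case (Cons g gs)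
  have row: "map letter [e..<e + Suc g] = replicate g False @ [True]"
    "counts (e + Suc g) = (rows (Suc v), Suc v)"
    using counts_row[of e "rows v" v g] Cons.prems(1) Cons.prems(2)[of 0] by auto
  have "rows (Suc v + i) + gs ! i = rows (Suc v + i + 1)" if "i < length gs" for i
    using Cons.prems(2)[of "Suc i"] that by simp
  from Cons.IH[OF row(2) this]
  have rest: "map letter [e + Suc g..<e + Suc g + length (gap_word gs)] = gap_word gs"
    "counts (e + Suc g + length (gap_word gs)) = (rows (Suc v + length gs), Suc v + length gs)"
    by blast+
  have "[e..<e + length (gap_word (g # gs))] =
      [e..<e + Suc g] @ [e + Suc g..<e + Suc g + length (gap_word gs)]"
    by (subst upt_add_eq_append[symmetric]) (simp_all add: algebra_simps)
  then show ?case
    using row(1) rest by (simp add: algebra_simps del: upt_Suc)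
qed

text \<open>A greedy parsing: the next three gaps decide between a core and a detour whose long gap
  comes first, second or third.\<close>

definition block_type :: "nat \<Rightarrow> nat" where
  "block_type v = (if \<lfloor>z (v + 1)\<rfloor> \<noteq> \<lfloor>z v\<rfloor> then 1 else if \<lfloor>z (v + 2)\<rfloor> \<noteq> \<lfloor>z (v + 1)\<rfloor> then 2
     else if \<lfloor>z (v + 3)\<rfloor> \<noteq> \<lfloor>z (v + 2)\<rfloor> then 3 else 0)"

lemma block_type_less: "block_type v < 4"
  by (simp add: block_type_def)

lemma floor_z_mono: "v \<le> w \<Longrightarrow> \<lfloor>z v\<rfloor> \<le> \<lfloor>z w\<rfloor>"
  using \<delta> by (intro floor_mono) (simp add: z_def mult_left_mono)

lemma floor_z_20: "w \<le> v + 20 \<Longrightarrow> \<lfloor>z w\<rfloor> \<le> \<lfloor>z v\<rfloor> + 1"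
proof -
  assume "w \<le> v + 20"
  then have "\<delta> * (real w - real v) \<le> \<delta> * 20"
    using \<delta> by (intro mult_left_mono) auto
  then have "z w \<le> z v + 1"
    using \<delta> z_diff[of w v] by simp
  then show ?thesis
    by linarith
qed

lemma rows_Suc:
  assumes "0 < v" "int g = 3 + \<lfloor>z (Suc v)\<rfloor> - \<lfloor>z v\<rfloor>"
  shows "rows v + g = rows (v + 1)"
  using rows_eq[of v] rows_eq[of "Suc v"] assms by simp

text \<open>Over 20 columns the floor of \<open>z\<close> rises by at most 1. In a detour the jump
  at position \<open>block_type v\<close> uses this up, so all its other gaps are 3.\<close>

lemma rows_block:
  assumes v: "0 < v" and i: "i < length (block_gaps (block_type v))"
  shows "rows (v + i) + block_gaps (block_type v) ! i = rows (v + i + 1)"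
    and "\<lfloor>z (v + length (block_gaps (block_type v)))\<rfloor> =
      \<lfloor>z v\<rfloor> + (if block_type v = 0 then 0 else 1)"
proof -
  define t where "t = block_type v"
  have t4: "t < 4"
    by (simp add: t_def block_type_less)
  have floor: "\<lfloor>z (v + l)\<rfloor> = (if t \<noteq> 0 \<and> t \<le> l then \<lfloor>z v\<rfloor> + 1 else \<lfloor>z v\<rfloor>)"
    if l: "l \<le> (if t = 0 then 3 else 20)" for l
  proof -
    have le: "l = 0 \<or> l = 1 \<or> l = 2 \<or> 3 \<le> l"
      by linarith
    have "\<lfloor>z v\<rfloor> \<le> \<lfloor>z (v + l)\<rfloor>" "\<lfloor>z (v + l)\<rfloor> \<le> \<lfloor>z v\<rfloor> + 1"
      using floor_z_mono[of v "v + l"] floor_z_20[of "v + l" v] l by (auto split: if_splits)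
    moreover have "\<lfloor>z v\<rfloor> \<le> \<lfloor>z (v + 1)\<rfloor>" "\<lfloor>z (v + 1)\<rfloor> \<le> \<lfloor>z (v + 2)\<rfloor>"
      "\<lfloor>z (v + 2)\<rfloor> \<le> \<lfloor>z (v + 3)\<rfloor>" "3 \<le> l \<Longrightarrow> \<lfloor>z (v + 3)\<rfloor> \<le> \<lfloor>z (v + l)\<rfloor>"
      "\<lfloor>z (v + 3)\<rfloor> \<le> \<lfloor>z v\<rfloor> + 1"
      by (auto intro: floor_z_mono floor_z_20)
    ultimately show ?thesis
      using le l unfolding t_def block_type_def by (auto split: if_splits)
  qed
  have len: "length (block_gaps t) = (if t = 0 then 3 else 20)"
    by (simp add: block_gaps_def)
  have nth: "block_gaps t ! i = (if t \<noteq> 0 \<and> i = t - 1 then 4 else 3)"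
  proof (cases "t = 0")
    case True
    then have "i = 0 \<or> i = 1 \<or> i = 2"
      using i t_def len by auto
    then show ?thesis
      using True by (auto simp: block_gaps_def)
  next
    case False
    then show ?thesis
      using i t_def len t4 by (simp add: block_gaps_def nth_list_update)
  qed
  show "rows (v + i) + block_gaps (block_type v) ! i = rows (v + i + 1)"
    unfolding t_def[symmetric]
    by (rule rows_Suc)
      (use v i len nth floor[of i] floor[of "Suc i"] in \<open>auto simp flip: t_def split: if_splits\<close>)
  show "\<lfloor>z (v + length (block_gaps (block_type v)))\<rfloor> =
      \<lfloor>z v\<rfloor> + (if block_type v = 0 then 0 else 1)"
    unfolding t_def[symmetric] using floor[of "length (block_gaps t)"] len t4 by auto
qed

definition first_gaps :: "nat list" where
  "first_gaps = start_gaps (rows 1)"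

lemma floor_z_start: "0 < v \<Longrightarrow> v \<le> 14 \<Longrightarrow> \<lfloor>z v\<rfloor> = \<lfloor>y0 - 3 * x0\<rfloor>"
proof -
  assume v: "0 < v" "v \<le> 14"
  have "0 \<le> \<delta> * (real v - x0)" "\<delta> * (real v - x0) \<le> \<delta> * 14"
    using \<delta> v x0 by (auto intro!: mult_nonneg_nonneg mult_left_mono)
  then show ?thesis
    using start by (intro floor_unique) (auto simp: z_def frac_def, linarith+)
qed

text \<open>The reason for four beginnings: y0 - 3 x0 < 1, and up to column 14 the drift \<delta>
  does not alter the floor.\<close>

lemma rows_1: "rows 1 < 4"
proof -
  have "y0 - 3 * x0 < 1"
    using x0 y0 by simp
  then have "\<lfloor>y0 - 3 * x0\<rfloor> < 1"
    by (simp add: floor_less_iff)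
  moreover have "int (rows 1) = 3 + \<lfloor>y0 - 3 * x0\<rfloor>"
    using rows_eq[of 1] floor_z_start[of 1] by simp
  ultimately show ?thesis
    by linarith
qed

lemma length_first_gaps: "length first_gaps \<le> 14" "0 < length first_gaps"
proof -
  have "rows 1 = 0 \<or> rows 1 = 1 \<or> rows 1 = 2 \<or> rows 1 = 3"
    using rows_1 by auto
  then show "length first_gaps \<le> 14" "0 < length first_gaps"
    by (auto simp: first_gaps_def start_gaps_def)
qed

lemma rows_first:
  assumes "i < length first_gaps"
  shows "rows (0 + i) + first_gaps ! i = rows (0 + i + 1)"
proof (cases i)
  case 0
  then show ?thesis
    by (simp add: first_gaps_def start_gaps_def rows_def)
next
  case (Suc j)
  have "first_gaps ! i = 3"
    using assms Suc by (simp add: first_gaps_def start_gaps_def)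
  moreover have "rows i + 3 = rows (i + 1)"
    by (rule rows_Suc)
      (use Suc assms length_first_gaps floor_z_start[of i] floor_z_start[of "Suc i"] in auto)
  ultimately show ?thesis
    by simp
qed

text \<open>Block boundaries are measured on three clocks: vertical lines crossed
  (\<open>block_column\<close>), all lines crossed (\<open>block_event\<close>) and walls hit
  (\<open>block_start\<close>).\<close>

primrec block_column :: "nat \<Rightarrow> nat" where
  "block_column 0 = length first_gaps"
| "block_column (Suc n) = block_column n + length (block_gaps (block_type (block_column n)))"

abbreviation kind :: "nat \<Rightarrow> nat" where
  "kind n \<equiv> block_type (block_column n)"

primrec block_event :: "nat \<Rightarrow> nat" where
  "block_event 0 = length (gap_word first_gaps)"
| "block_event (Suc n) = block_event n + length (gap_word (block_gaps (kind n)))"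

definition block_cell :: "nat \<Rightarrow> cell" where
  "block_cell n = cell (block_event n)"

definition block_start :: "nat \<Rightarrow> nat" where
  "block_start n = length (hits (block_event n))"

lemma block_column_pos: "0 < block_column n"
  by (induction n) (use length_first_gaps in auto)

lemma block_invariant:
  "counts (block_event n) = (rows (block_column n), block_column n) \<and>
   settled (block_cell n) (set (hits (block_event n)))"
proof (induction n)
  case 0
  have "counts 0 = (rows 0, 0)"
    by (simp add: rows_def)
  note word = counts_word[OF this rows_first]
  from conf_run[of 0 "gap_word first_gaps"] word
  have "conf (block_event 0) = run (gap_word first_gaps) origin {}"
    by simp
  then show ?case
    using word settled_start[OF rows_1] by (auto simp: first_gaps_def block_cell_def split: prod.splits)
next
  case (Suc n)
  then have counts: "counts (block_event n) = (rows (block_column n), block_column n)"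
    and settled: "settled (block_cell n) (set (hits (block_event n)))"
    by auto
  note word = counts_word[OF counts rows_block(1)[OF block_column_pos]]
  from conf_run[of "block_event n" "gap_word (block_gaps (kind n))"] word
    run_block[OF block_type_less settled, of "block_column n"]
  show ?case
    by (auto simp: block_cell_def)
qed

lemma block_step:
  "block_cell (Suc n) = place_cell (block_cell n) (block_shift (kind n))"
  "hits (block_event (Suc n)) = hits (block_event n) @ map (place (block_cell n)) (block_walls (kind n))"
proof -
  have counts: "counts (block_event n) = (rows (block_column n), block_column n)"
    and settled: "settled (block_cell n) (set (hits (block_event n)))"
    using block_invariant by auto
  note word = counts_word[OF counts rows_block(1)[OF block_column_pos]]
  from conf_run[of "block_event n" "gap_word (block_gaps (kind n))"] word
    run_block[OF block_type_less settled, of "block_column n"]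
  show "block_cell (Suc n) = place_cell (block_cell n) (block_shift (kind n))"
    "hits (block_event (Suc n)) = hits (block_event n) @ map (place (block_cell n)) (block_walls (kind n))"
    by (simp_all add: block_cell_def)
qed

declare block_event.simps [simp del] block_column.simps [simp del]

lemma block_start_Suc: "block_start (Suc n) = block_start n + length (block_walls (kind n))"
  by (simp add: block_start_def block_step)

lemma block_start_less: "block_start n < block_start (Suc n)"
  using block_walls_lengths(1)[OF block_type_less, of "block_column n"]
  by (simp add: block_start_Suc split: if_splits)

lemma strict_mono_block_start: "strict_mono block_start"
  by (simp add: strict_mono_Suc_iff block_start_less)

lemma unbounded_hits: "\<exists>e. n < length (hits e)"
  using strict_mono_imp_increasing[OF strict_mono_block_start, of "Suc n"]
  by (auto simp: block_start_def Suc_le_eq)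

lemmas hits_eq = hits_eq_walls[OF unbounded_hits]

lemma walls_block:
  assumes "r < length (block_walls (kind n))"
  shows "walls (block_start n + r) = place (block_cell n) (block_walls (kind n) ! r)"
proof -
  have "walls (block_start n + r) = hits (block_event (Suc n)) ! (block_start n + r)"
    by (subst hits_eq) (use assms in \<open>simp add: block_start_Suc flip: block_start_def\<close>)
  also have "\<dots> = place (block_cell n) (block_walls (kind n) ! r)"
    using assms by (simp add: block_step(2) nth_append block_start_def)
  finally show ?thesis .
qed

lemma find_block:
  assumes "block_start i \<le> a"
  obtains n r where "i \<le> n" "r < length (block_walls (kind n))" "a = block_start n + r"
proof -
  define n where "n = (LEAST n. a < block_start (Suc n))"
  have "a < block_start (Suc a)"
    using strict_mono_imp_increasing[OF strict_mono_block_start, of "Suc a"] by simp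
  then have n: "a < block_start (Suc n)"
    unfolding n_def by (rule LeastI)
  have "i \<le> n"
  proof (rule ccontr)
    assume "\<not> i \<le> n"
    then have "block_start (Suc n) \<le> block_start i"
      by (simp add: strict_mono_less_eq[OF strict_mono_block_start])
    then show False
      using n assms by simp
  qed
  have "block_start n \<le> a"
  proof (cases "n = i")
    case True
    then show ?thesis using assms by simp
  next
    case False
    with \<open>i \<le> n\<close> obtain m where m: "n = Suc m"
      by (cases n) auto
    then show ?thesis
      using not_less_Least[of m "\<lambda>n. a < block_start (Suc n)"] by (simp add: n_def)
  qed
  with n \<open>i \<le> n\<close> show ?thesis
    by (intro that[of n "a - block_start n"]) (auto simp: block_start_Suc)
qed

text \<open>\<open>k\<close> and \<open>m\<close> count the blocks without and with a long gap among the first \<open>n\<close> blocks.\<close>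

lemma block_counts:
  obtains k m :: nat where
    "block_cell n = place_cell (block_cell 0) (int k + 4 * int m, int k + 5 * int m, True, True)"
    "block_column n = block_column 0 + 3 * k + 20 * m"
    "int m = \<lfloor>z (block_column n)\<rfloor> - \<lfloor>z (block_column 0)\<rfloor>"
    "block_start n = block_start 0 + 6 * k + 32 * m"
    "length (filter is_Vertical (hits (block_event n))) =
     length (filter is_Vertical (hits (block_event 0))) + 2 * k + 12 * m"
proof -
  have "\<exists>k m :: nat.
    block_cell n = place_cell (block_cell 0) (int k + 4 * int m, int k + 5 * int m, True, True) \<and>
    block_column n = block_column 0 + 3 * k + 20 * m \<and>
    int m = \<lfloor>z (block_column n)\<rfloor> - \<lfloor>z (block_column 0)\<rfloor> \<and>
    block_start n = block_start 0 + 6 * k + 32 * m \<and>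
    length (filter is_Vertical (hits (block_event n))) =
    length (filter is_Vertical (hits (block_event 0))) + 2 * k + 12 * m"
  proof (induction n)
    case 0
    show ?case
      by (rule exI[of _ 0], rule exI[of _ 0]) (use place_cell_origin in \<open>simp add: origin_def\<close>)
  next
    case (Suc n)
    then obtain k m :: nat where IH:
      "block_cell n = place_cell (block_cell 0) (int k + 4 * int m, int k + 5 * int m, True, True)"
      "block_column n = block_column 0 + 3 * k + 20 * m"
      "int m = \<lfloor>z (block_column n)\<rfloor> - \<lfloor>z (block_column 0)\<rfloor>"
      "block_start n = block_start 0 + 6 * k + 32 * m"
      "length (filter is_Vertical (hits (block_event n))) =
       length (filter is_Vertical (hits (block_event 0))) + 2 * k + 12 * m"
      by blast
    note len = block_walls_lengths[OF block_type_less, of "block_column n"]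
    have "0 < length (block_gaps (kind n))"
      by (simp add: block_gaps_def)
    note rows = rows_block(2)[OF block_column_pos this]
    have filt: "is_Vertical \<circ> place f = is_Vertical" for f
      by (simp add: fun_eq_iff)
    define k' m' where "k' = (if kind n = 0 then k + 1 else k)"
      and "m' = (if kind n = 0 then m else m + 1)"
    have "block_cell (Suc n) = place_cell (block_cell 0) (int k' + 4 * int m', int k' + 5 * int m', True, True)"
      by (simp add: block_step IH(1) place_cell_assoc block_shift_def k'_def m'_def algebra_simps)
    moreover have "block_column (Suc n) = block_column 0 + 3 * k' + 20 * m'"
      using IH(2) by (simp add: block_column.simps(2) block_gaps_def k'_def m'_def)
    moreover have "int m' = \<lfloor>z (block_column (Suc n))\<rfloor> - \<lfloor>z (block_column 0)\<rfloor>"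
      using IH(3) rows by (simp add: block_column.simps(2) m'_def)
    moreover have "block_start (Suc n) = block_start 0 + 6 * k' + 32 * m'"
      using IH(4) len by (simp add: block_start_Suc k'_def m'_def)
    moreover have "length (filter is_Vertical (hits (block_event (Suc n)))) =
        length (filter is_Vertical (hits (block_event 0))) + 2 * k' + 12 * m'"
      using IH(5) len by (simp add: block_step(2) filter_map filt k'_def m'_def)
    ultimately show ?case
      by blast
  qed
  then show ?thesis
    using that by blast
qed

text \<open>Rounding by the two floors costs less than 1, and the columns before the first block
  cost at most 14 \<delta> < 1.\<close>

lemma long_gap_count:
  assumes "int m = \<lfloor>z (block_column n)\<rfloor> - \<lfloor>z (block_column 0)\<rfloor>"
  shows "\<bar>real m - \<delta> * real (block_column n)\<bar> \<le> 2"
proof -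
  have "real m = of_int \<lfloor>z (block_column n)\<rfloor> - of_int \<lfloor>z (block_column 0)\<rfloor>"
    using assms by linarith
  moreover have "z (block_column n) - z (block_column 0) =
      \<delta> * real (block_column n) - \<delta> * real (block_column 0)"
    by (simp add: z_diff algebra_simps)
  moreover have "\<delta> * real (block_column 0) \<le> \<delta> * 14" "0 \<le> \<delta> * real (block_column 0)"
    using \<delta> length_first_gaps by (auto simp: block_column.simps(1) intro!: mult_left_mono)
  ultimately show ?thesis
    using \<delta> by linarith
qed

lemma distinct_hits: "distinct (hits e)"
proof (induction e)
  case (Suc e)
  then show ?case
    using conf_pass[of e] conf_bounce[of e]
    by (cases "crossed (letter e) (cell e) \<in> set (hits e)") auto
qed simp

lemma inj_walls: "inj walls"
proof (rule injI)
  fix m n assume eq: "walls m = walls n"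
  obtain e where e: "max m n < length (hits e)"
    using unbounded_hits by blast
  have "distinct (map walls [0..<length (hits e)])"
    using distinct_hits[of e] hits_eq[of e] by simp
  then show "m = n"
    using eq e by (auto simp: distinct_map dest: inj_onD)
qed

end

section \<open>Walls near the origin and walls near a cell\<close>

lemma finite_walls_near: "finite {w. \<not> outside_disc r w}"
proof -
  define S where "S = {- \<lceil>\<bar>r\<bar>\<rceil> - 1..\<lceil>\<bar>r\<bar>\<rceil> + 1}"
  have S: "k \<in> S" if "of_int k \<le> t" "t \<le> of_int k + 1" "\<bar>t\<bar> \<le> \<bar>r\<bar>" for k t
    using that unfolding S_def atLeastAtMost_iff by linarith
  have "w \<in> (Horizontal ` (S \<times> S)) \<union> (Vertical ` (S \<times> S))" if "\<not> outside_disc r w" for w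
  proof -
    have "\<exists>p. p \<in> wall_set w \<and> p \<in> cball 0 r"
      using that unfolding outside_disc_def by blast
    then obtain x y where p: "(x, y) \<in> wall_set w" "norm (x, y) \<le> r"
      by (metis mem_cball_0 prod.collapse)
    then have "\<bar>x\<bar> \<le> \<bar>r\<bar>" "\<bar>y\<bar> \<le> \<bar>r\<bar>"
      using norm_fst_le[of x y] norm_snd_le[of y x] by auto
    then show ?thesis
      using p(1) S[of _ x] S[of _ y] by (cases w; cases "base w") auto
  qed
  then have "{w. \<not> outside_disc r w} \<subseteq> Horizontal ` (S \<times> S) \<union> Vertical ` (S \<times> S)"
    by blast
  then show ?thesis
    by (rule finite_subset) (simp add: S_def)
qed

text \<open>Only finitely many walls meet a disc, and each is hit at most once.\<close>

lemma eventually_outside_disc: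
  fixes W :: "nat \<Rightarrow> wall"
  assumes "inj W"
  obtains n0 where "\<And>n. n0 \<le> n \<Longrightarrow> outside_disc r (W n)"
proof -
  have "finite (W -` {w. \<not> outside_disc r w})"
    by (rule finite_vimageI[OF finite_walls_near assms])
  then have "\<exists>n0. W -` {w. \<not> outside_disc r w} \<subseteq> {..<n0}"
    by (simp only: finite_nat_iff_bounded)
  then obtain n0 where n0: "W -` {w. \<not> outside_disc r w} \<subseteq> {..<n0}"
    by (rule exE)
  have "outside_disc r (W n)" if "n0 \<le> n" for n
  proof (rule ccontr)
    assume "\<not> outside_disc r (W n)"
    then have "n < n0"
      using n0 by auto
    then show False
      using that by simp
  qed
  then show ?thesis
    by (rule that)
qed

text \<open>A disc that contains a point of each of the first \<open>n0\<close> walls excludes them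
  all.\<close>

lemma outside_disc_large:
  obtains r0 where "\<And>r n. r0 \<le> r \<Longrightarrow> outside_disc r (W n) \<Longrightarrow> n0 \<le> (n::nat)"
proof -
  have "\<exists>p. p \<in> wall_set (W n)" for n
  proof -
    obtain i j where "W n = Horizontal (i, j) \<or> W n = Vertical (i, j)"
      by (cases "W n") auto
    then have "(of_int i, of_int j) \<in> wall_set (W n)"
      by auto
    then show ?thesis
      by blast
  qed
  then obtain p where p: "\<And>n. p n \<in> wall_set (W n)"
    by metis
  have "n0 \<le> n" if "(\<Sum>i<n0. norm (p i)) \<le> r" "outside_disc r (W n)" for r n
  proof (rule ccontr)
    assume "\<not> n0 \<le> n"
    then have "norm (p n) \<le> (\<Sum>i<n0. norm (p i))"
      by (intro member_le_sum) auto
    then have "p n \<in> wall_set (W n) \<inter> cball 0 r"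
      using p that by simp
    then show False
      using that by (auto simp: outside_disc_def)
  qed
  then show ?thesis
    by (rule that)
qed

lemma wall_near_cell:
  "\<exists>M. \<forall>i j r u p. p \<in> wall_set (place (i, j, r, u) w) \<longrightarrow>
    \<bar>fst p - of_int i\<bar> \<le> M \<and> \<bar>snd p - of_int j\<bar> \<le> (M::real)"
proof -
  obtain a b where "w = Horizontal (a, b) \<or> w = Vertical (a, b)"
    by (cases w) auto
  then show ?thesis
    by (intro exI[of _ "\<bar>of_int a\<bar> + \<bar>of_int b\<bar> + 2"]) (auto simp: abs_if split: if_splits)
qed

lemma walls_near_cell:
  assumes "finite S"
  shows "\<exists>M. \<forall>w\<in>S. \<forall>i j r u p. p \<in> wall_set (place (i, j, r, u) w) \<longrightarrow>
    \<bar>fst p - of_int i\<bar> \<le> M \<and> \<bar>snd p - of_int j\<bar> \<le> (M::real)"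
  using assms
proof (induction S)
  case (insert w S)
  then obtain M where M: "\<forall>w\<in>S. \<forall>i j r u p. p \<in> wall_set (place (i, j, r, u) w) \<longrightarrow>
    \<bar>fst p - of_int i\<bar> \<le> M \<and> \<bar>snd p - of_int j\<bar> \<le> M"
    by blast
  obtain M' where M': "\<forall>i j r u p. p \<in> wall_set (place (i, j, r, u) w) \<longrightarrow>
    \<bar>fst p - of_int i\<bar> \<le> M' \<and> \<bar>snd p - of_int j\<bar> \<le> M'"
    using wall_near_cell by blast
  show ?case
    by (rule exI[of _ "max M M'"]) (use M M' in \<open>fastforce simp: le_max_iff_disj\<close>)
qed simp

lemma base_place_translate:
  "base (place (i + a, j + b, r, u) w) = base (place (i, j, r, u) w) + (a, b)"
  "is_Horizontal (place (i + a, j + b, r, u) w) = is_Horizontal (place (i, j, r, u) w)"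
  by (cases w; auto)+

context steep_trajectory
begin

text \<open>The ratio of (V - 5 m) / 3 to (V - 8 m) / 3 for m = \<delta> V; with
  \<open>s = 3 + \<delta>\<close> it is the slope of the theorem.\<close>

definition slope :: real where
  "slope = (1 - 5 * \<delta>) / (1 - 8 * \<delta>)"

text \<open>Block shifts preserve orientation, so the frames advance with the fixed signs
  \<open>sx\<close> and \<open>sy\<close>. At column V the frame is within bounded distance of (V /
  3) d, and the walls of a block are within a bounded distance \<open>M\<close> of its frame. One
  band, from the origin, is enough.\<close>

lemma tunnel_band:
  obtains b where "is_band b" "band_has_abs_slope b slope"
    "\<And>n. block_start 0 \<le> n \<Longrightarrow> wall_set (walls n) \<subseteq> b"
proof -
  obtain i0 j0 r u where cell0: "block_cell 0 = (i0, j0, r, u)"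
    by (metis prod_cases4)
  define sx sy :: real where "sx = (if r then 1 else -1)" and "sy = (if u then 1 else -1)"
  define d where "d = (sx * (1 - 8 * \<delta>), sy * (1 - 5 * \<delta>))"
  obtain M where M: "\<And>t w i j r u p. t < 4 \<Longrightarrow> w \<in> set (block_walls t) \<Longrightarrow>
    p \<in> wall_set (place (i, j, r, u) w) \<Longrightarrow> \<bar>fst p - of_int i\<bar> \<le> M \<and> \<bar>snd p - of_int j\<bar> \<le> (M::real)"
  proof -
    have "finite (\<Union>t\<in>{..<4}. set (block_walls t))"
      by simp
    from walls_near_cell[OF this] that show ?thesis
      by blast
  qed
  \<comment> \<open>The norm is at most the sum of the coordinates, each bounded as in
    \<open>near\<close>.\<close>
  define R where "R = (M + \<bar>of_int i0\<bar> + \<bar>of_int j0\<bar> + 20) * 2"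
  have near: "\<bar>fst p - sx * (1 - 8 * \<delta>) * (real (block_column n) / 3)\<bar> \<le> M + \<bar>of_int i0\<bar> + 20 \<and>
      \<bar>snd p - sy * (1 - 5 * \<delta>) * (real (block_column n) / 3)\<bar> \<le> M + \<bar>of_int j0\<bar> + 20"
    if w: "w \<in> set (block_walls (kind n))" and p: "p \<in> wall_set (place (block_cell n) w)" for n w p
  proof -
    obtain k m :: nat where km:
      "block_cell n = place_cell (block_cell 0) (int k + 4 * int m, int k + 5 * int m, True, True)"
      "block_column n = block_column 0 + 3 * k + 20 * m"
      "int m = \<lfloor>z (block_column n)\<rfloor> - \<lfloor>z (block_column 0)\<rfloor>"
      by (rule block_counts)
    define V where "V = real (block_column n)"
    have m: "\<bar>real m - \<delta> * V\<bar> \<le> 2"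
      using long_gap_count[OF km(3)] by (simp add: V_def)
    have V: "V = real (block_column 0) + 3 * real k + 20 * real m"
      and V0: "0 \<le> real (block_column 0)" "real (block_column 0) \<le> 14"
      using km(2) length_first_gaps by (simp_all add: V_def block_column.simps(1))
    have a: "\<bar>(real k + 4 * real m) - (1 - 8 * \<delta>) * (V / 3)\<bar> \<le> 20"
      "\<bar>(real k + 5 * real m) - (1 - 5 * \<delta>) * (V / 3)\<bar> \<le> 20"
    proof -
      \<comment> \<open>Eliminating \<open>k\<close> and \<delta> V leaves only the bounded
        discrepancy \<mu> and the first column: at most (14 + 8 * 2) / 3.\<close>
      define \<mu> where "\<mu> = real m - \<delta> * V"
      have \<mu>: "\<bar>\<mu>\<bar> \<le> 2"
        using m by (simp add: \<mu>_def)
      have "\<delta> * V = real m - \<mu>"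
        by (simp add: \<mu>_def)
      then have eq: "(1 - 8 * \<delta>) * (V / 3) = (V - 8 * (real m - \<mu>)) / 3"
        "(1 - 5 * \<delta>) * (V / 3) = (V - 5 * (real m - \<mu>)) / 3"
        by (simp_all add: algebra_simps diff_divide_distrib)
      have diff: "(real k + 4 * real m) - (1 - 8 * \<delta>) * (V / 3) = - (real (block_column 0) + 8 * \<mu>) / 3"
        "(real k + 5 * real m) - (1 - 5 * \<delta>) * (V / 3) = - (real (block_column 0) + 5 * \<mu>) / 3"
        unfolding eq by (simp_all add: V field_simps)
      have "\<bar>- (real (block_column 0) + 8 * \<mu>) / 3\<bar> \<le> 20"
        "\<bar>- (real (block_column 0) + 5 * \<mu>) / 3\<bar> \<le> 20"
        using \<mu> V0 by (simp_all add: abs_le_iff)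
      then show "\<bar>(real k + 4 * real m) - (1 - 8 * \<delta>) * (V / 3)\<bar> \<le> 20"
        "\<bar>(real k + 5 * real m) - (1 - 5 * \<delta>) * (V / 3)\<bar> \<le> 20"
        unfolding diff .
    qed
    define i j where "i = (if r then i0 + (int k + 4 * int m) else i0 - (int k + 4 * int m))"
      and "j = (if u then j0 + (int k + 5 * int m) else j0 - (int k + 5 * int m))"
    have cell: "block_cell n = (i, j, r, u)"
      by (auto simp: km(1) cell0 i_def j_def)
    have "\<bar>fst p - of_int i\<bar> \<le> M \<and> \<bar>snd p - of_int j\<bar> \<le> M"
      using M[OF block_type_less w] p cell by simp
    moreover have "of_int i - sx * (1 - 8 * \<delta>) * (V / 3) =
        of_int i0 + sx * ((real k + 4 * real m) - (1 - 8 * \<delta>) * (V / 3))"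
      "of_int j - sy * (1 - 5 * \<delta>) * (V / 3) =
        of_int j0 + sy * ((real k + 5 * real m) - (1 - 5 * \<delta>) * (V / 3))"
      by (simp_all add: i_def j_def sx_def sy_def algebra_simps)
    moreover have "\<bar>sx * y\<bar> = \<bar>y\<bar>" "\<bar>sy * y\<bar> = \<bar>y\<bar>" for y
      by (simp_all add: sx_def sy_def)
    ultimately show ?thesis
      unfolding V_def[symmetric] using a by (smt (verit))
  qed
  have "0 \<le> R"
  proof -
    obtain w where w: "w \<in> set (block_walls (kind 0))"
      using block_walls_lengths(1)[OF block_type_less, of "block_column 0"]
      by (cases "block_walls (kind 0)") (auto split: if_splits)
    obtain p where "p \<in> wall_set (place (block_cell 0) w)"
      by (cases "place (block_cell 0) w"; cases "base (place (block_cell 0) w)") force+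
    then have "\<bar>fst p - of_int i0\<bar> \<le> M"
      using M[OF block_type_less w, of p i0 j0 r u] cell0 by simp
    then have "0 \<le> M"
      by linarith
    then show ?thesis
      by (simp add: R_def)
  qed
  have d: "fst d \<noteq> 0"
    using \<delta> by (simp add: d_def sx_def)
  show ?thesis
  proof (rule that[of "band 0 d R"])
    show "is_band (band 0 d R)"
      unfolding is_band_def using d \<open>0 \<le> R\<close> by (metis fst_zero)
    have "slope = \<bar>snd d / fst d\<bar>"
      using \<delta> by (simp add: slope_def d_def sx_def sy_def)
    then show "band_has_abs_slope (band 0 d R) slope"
      unfolding band_has_abs_slope_def using d \<open>0 \<le> R\<close> by blast
    fix a assume "block_start 0 \<le> a"
    then obtain n l where n: "l < length (block_walls (kind n))" "a = block_start n + l"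
      by (rule find_block)
    show "wall_set (walls a) \<subseteq> band 0 d R"
    proof
      fix p assume p: "p \<in> wall_set (walls a)"
      let ?t = "real (block_column n) / 3"
      have "norm (p - ?t *\<^sub>R d) \<le> norm (fst (p - ?t *\<^sub>R d)) + norm (snd (p - ?t *\<^sub>R d))"
        by (metis norm_Pair_le prod.collapse)
      also have "\<dots> \<le> R"
        using near[of "block_walls (kind n) ! l" n p] n p walls_block[OF n(1)]
        by (auto simp: d_def R_def algebra_simps)
      finally have "dist p (0 + ?t *\<^sub>R d) \<le> R"
        by (simp add: dist_norm)
      moreover have "0 + ?t *\<^sub>R d \<in> ray 0 d"
        unfolding ray_def by (rule CollectI, rule exI[of _ ?t]) simp
      ultimately show "p \<in> band 0 d R"
        unfolding band_def by blast
    qed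
  qed
qed

lemma tunnel_bands_cover:
  obtains b r0 where "band_has_abs_slope b slope" "\<And>r. r0 \<le> r \<Longrightarrow> bands_cover {b} r walls"
proof -
  obtain b where b: "is_band b" "band_has_abs_slope b slope"
    "\<And>n. block_start 0 \<le> n \<Longrightarrow> wall_set (walls n) \<subseteq> b"
    using tunnel_band by blast
  obtain r0 where "\<And>r n. r0 \<le> r \<Longrightarrow> outside_disc r (walls n) \<Longrightarrow> block_start 0 \<le> n"
    using outside_disc_large by blast
  then show ?thesis
    using b by (intro that[of b r0]) (auto simp: bands_cover_def)
qed

lemma tunnels_walls: "tunnels (x0, y0) s walls"
  unfolding tunnels_def using collision_sequence_walls[OF unbounded_hits] tunnel_bands_cover
  by (meson order_refl)

lemma tunnel_has_slope_walls: "tunnel_has_slope walls (1 + (3 * s - 9) / (25 - 8 * s))"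
proof -
  have "1 + (3 * s - 9) / (25 - 8 * s) = slope"
    using \<delta> by (simp add: slope_def s_eq field_simps)
  then show ?thesis
    unfolding tunnel_has_slope_def using tunnel_bands_cover
    by (metis order_refl singletonD)
qed

section \<open>Rational slopes give periodic tunnels\<close>

lemma block_type_mod:
  assumes "0 < q" "\<delta> * real q = real p" "v mod q = w mod q"
  shows "block_type v = block_type w"
proof -
  have *: "block_type v = block_type w" if le: "v \<le> w" and mod: "v mod q = w mod q" for v w
  proof -
    obtain l where l: "w = v + q * l"
      by (rule mod_eq_nat1E[OF mod[symmetric] le])
    \<comment> \<open>Over q columns \<open>z\<close> grows by the integer p, so differences of its
      floors repeat.\<close>
    have floor: "\<lfloor>z (w + i)\<rfloor> = \<lfloor>z (v + i)\<rfloor> + int p * int l" for i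
    proof -
      have "z (w + i) - z (v + i) = (\<delta> * real q) * real l"
        by (simp add: z_diff l algebra_simps)
      then have "z (w + i) = z (v + i) + of_int (int p * int l)"
        by (simp add: assms)
      then show ?thesis
        by linarith
    qed
    have "\<lfloor>z w\<rfloor> = \<lfloor>z v\<rfloor> + int p * int l"
      using floor[of 0] by simp
    then show ?thesis
      unfolding block_type_def floor by simp
  qed
  show ?thesis
    using *[of v w] *[of w v] assms by (metis linear)
qed

text \<open>By pigeonhole two blocks begin at columns congruent modulo q. From there the block types
  repeat every \<open>Q\<close> blocks, and so do the walls up to a translation. The period
  \<open>k\<close> is the number of hits in \<open>Q\<close> blocks.\<close>

lemma periodic_walls:
  assumes "\<delta> \<in> \<rat>"
  shows "periodic_tunnel walls"
proof -
  obtain p q :: nat where q: "q \<noteq> 0" "\<bar>\<delta>\<bar> = real p / real q"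
    using assms Rats_abs_nat_div_natE by blast
  then have pq: "0 < q" "\<delta> * real q = real p"
    using \<delta> by (auto simp: field_simps)
  have "\<not> inj (\<lambda>n. block_column n mod q)"
  proof
    assume "inj (\<lambda>n. block_column n mod q)"
    moreover have "finite (range (\<lambda>n. block_column n mod q))"
      by (rule finite_subset[of _ "{..<q}"]) (use pq in auto)
    ultimately show False
      using finite_imageD by blast
  qed
  then obtain i j where ij: "i < j" "block_column i mod q = block_column j mod q"
    unfolding inj_def by (metis linorder_neqE_nat)
  define Q where "Q = j - i"
  have mod: "block_column (n + Q) mod q = block_column n mod q" if "i \<le> n" for n
    using that
  proof (induction n rule: dec_induct)
    case base
    then show ?case using ij by (simp add: Q_def)
  next
    case (step n)
    have "kind (n + Q) = kind n"
      by (rule block_type_mod[OF pq step.IH])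
    then show ?case
      using mod_add_cong[OF step.IH refl] by (simp add: block_column.simps(2))
  qed
  have kind: "kind (n + Q) = kind n" if "i \<le> n" for n
    using block_type_mod[OF pq mod[OF that]] .
  define k where "k = block_start (i + Q) - block_start i"
  have k: "block_start (n + Q) = block_start n + k" if "i \<le> n" for n
    using that
  proof (induction n rule: dec_induct)
    case base
    have "block_start i \<le> block_start (i + Q)"
      by (simp add: strict_mono_less_eq[OF strict_mono_block_start])
    then show ?case by (simp add: k_def)
  next
    case (step n)
    then show ?case
      using kind[of n] by (simp add: block_start_Suc)
  qed
  have "0 < k"
    using strict_mono_less[OF strict_mono_block_start, of i "i + Q"] ij by (simp add: k_def Q_def)
  have "\<exists>a b. \<forall>n\<ge>i. \<exists>x y r u. block_cell n = (x, y, r, u) \<and> block_cell (n + Q) = (x + a, y + b, r, u)"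
  proof -
    obtain x y r u where c: "block_cell i = (x, y, r, u)"
      by (metis prod_cases4)
    have ru: "\<exists>x y. block_cell n = (x, y, r, u)" if "i \<le> n" for n
      using that
    proof (induction n rule: dec_induct)
      case (step n)
      then show ?case by (auto simp: block_step block_shift_def)
    qed (use c in auto)
    obtain x' y' where c': "block_cell (i + Q) = (x', y', r, u)"
      using ru[of "i + Q"] by auto
    have "\<exists>x y. block_cell n = (x, y, r, u) \<and> block_cell (n + Q) = (x + (x' - fst (block_cell i)),
        y + (y' - fst (snd (block_cell i))), r, u)" if "i \<le> n" for n
      using that
    proof (induction n rule: dec_induct)
      case base
      then show ?case by (simp add: c c')
    next
      case (step n)
      then show ?case
        using kind[of n] by (auto simp: block_step block_shift_def)
    qed
    then show ?thesis
      by metis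
  qed
  then obtain a b where ab: "\<And>n. i \<le> n \<Longrightarrow>
    \<exists>x y r u. block_cell n = (x, y, r, u) \<and> block_cell (n + Q) = (x + a, y + b, r, u)"
    by blast
  have shift: "(is_Horizontal (walls (n + k)) \<longleftrightarrow> is_Horizontal (walls n)) \<and>
    base (walls (n + k)) - base (walls n) = (a, b)" if "block_start i \<le> n" for n
  proof -
    obtain l r where l: "i \<le> l" "r < length (block_walls (kind l))" "n = block_start l + r"
      using find_block[OF \<open>block_start i \<le> n\<close>] .
    have "walls n = place (block_cell l) (block_walls (kind l) ! r)"
      using l walls_block by simp
    moreover have "walls (n + k) = place (block_cell (l + Q)) (block_walls (kind l) ! r)"
    proof -
      have "n + k = block_start (l + Q) + r"
        using l(3) k[OF l(1)] by simp
      then show ?thesis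
        using walls_block[of r "l + Q"] l(2) kind[OF l(1)] by (simp only:)
    qed
    ultimately show ?thesis
      using ab[OF l(1)] base_place_translate by auto
  qed
  obtain bd r1 where bd: "\<And>r. r1 \<le> r \<Longrightarrow> bands_cover {bd} r walls"
    using tunnel_bands_cover by blast
  obtain r2 where r2: "\<And>r n. r2 \<le> r \<Longrightarrow> outside_disc r (walls n) \<Longrightarrow> block_start i \<le> n"
    using outside_disc_large by blast
  show ?thesis
    unfolding periodic_tunnel_def
  proof (intro exI[of _ "{bd}"] eventually_at_top_linorderI[of "max r1 r2"] conjI)
    fix r assume r: "max r1 r2 \<le> r"
    show "bands_cover {bd} r walls"
      using bd r by simp
    show "\<forall>b\<in>{bd}. \<forall>b'\<in>{bd}. b \<noteq> b' \<longrightarrow> b \<inter> b' \<subseteq> cball 0 r"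
      by simp
    have "\<forall>n. outside_disc r (walls n) \<longrightarrow>
      (is_Horizontal (walls (n + k)) \<longleftrightarrow> is_Horizontal (walls n)) \<and>
      (\<forall>b'\<in>{bd}. wall_set (walls n) \<subseteq> b' \<longrightarrow> base (walls (n + k)) - base (walls n) = (a, b))"
      using shift r2 r by auto
    then show "\<exists>k>0. \<exists>displacement. \<forall>n. outside_disc r (walls n) \<longrightarrow>
      (is_Horizontal (walls (n + k)) \<longleftrightarrow> is_Horizontal (walls n)) \<and>
      (\<forall>b\<in>{bd}. wall_set (walls n) \<subseteq> b \<longrightarrow> base (walls (n + k)) - base (walls n) = displacement b)"
      using \<open>0 < k\<close> by (intro exI[of _ k] conjI exI[of _ "\<lambda>_. (a, b)"])
  qed
qed

end

section \<open>Periodic tunnels have rational slopes\<close>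

lemma periodic_tunnel_types:
  assumes "periodic_tunnel W"
  shows "\<exists>(r::real) k. 0 < k \<and> (\<forall>n. outside_disc r (W n) \<longrightarrow>
    (is_Horizontal (W (n + k)) \<longleftrightarrow> is_Horizontal (W n)))"
  using assms unfolding periodic_tunnel_def
  by (elim exE, drule_tac eventually_happens'[OF trivial_limit_at_top_linorder], elim exE conjE)
    (rename_tac B r k d, rule_tac x = r in exI, rule_tac x = k in exI, simp)

text \<open>With a the increase of f over one period, k f(n) - a n is itself k-periodic from n0 on,
  so it takes finitely many values.\<close>

lemma periodic_count:
  fixes f :: "nat \<Rightarrow> nat"
  assumes "0 < k" and Suc: "\<And>n. f (Suc n) = f n + (if A n then 1 else 0)"
    and per: "\<And>n. n0 \<le> n \<Longrightarrow> A (n + k) = A n"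
  obtains a :: nat and G :: real where "\<And>n. \<bar>real k * real (f n) - real a * real n\<bar> \<le> G"
proof -
  define a where "a = f (n0 + k) - f n0"
  have mono: "f n \<le> f (n + l)" for n l
    by (induction l) (simp_all add: Suc)
  have a: "f (n + k) = f n + a" if "n0 \<le> n" for n
    using that
  proof (induction n rule: dec_induct)
    case base
    then show ?case using mono[of n0 k] by (simp add: a_def)
  next
    case (step n)
    then show ?case using per[of n] Suc[of n] Suc[of "n + k"] by simp
  qed
  define g where "g n = real k * real (f n) - real a * real n" for n
  have g: "g (n + k) = g n" if "n0 \<le> n" for n
    using a[OF that] by (simp add: g_def algebra_simps)
  have "g n \<in> g ` {..n0 + k}" for n
  proof (induction n rule: less_induct)
    case (less n)
    show ?case
    proof (cases "n \<le> n0 + k")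
      case False
      then have "g n = g (n - k)" "n - k < n"
        using g[of "n - k"] \<open>0 < k\<close> by auto
      then show ?thesis
        using less[of "n - k"] by simp
    qed auto
  qed
  then have "finite (range g)"
    by (intro finite_subset[of "range g" "g ` {..n0 + k}"]) auto
  then obtain G where "\<And>n. \<bar>g n\<bar> \<le> G"
    using finite_imp_bounded[of "range g"] unfolding bounded_iff by auto
  then show ?thesis
    by (intro that[of a G]) (simp add: g_def)
qed

context steep_trajectory
begin

text \<open>Up to bounded errors, V columns produce (6 - 24 \<delta>) V / 3 hits, of which (2 - 4
  \<delta>) V / 3 are vertical. Periodicity equates the ratio with a / k, and this fractional linear
  equation has a rational solution.\<close>

lemma periodic_walls_imp_rational:
  assumes "periodic_tunnel walls"
  shows "\<delta> \<in> \<rat>"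
proof -
  obtain r k where "0 < k" and per0: "\<And>n. outside_disc r (walls n) \<Longrightarrow>
    is_Horizontal (walls (n + k)) \<longleftrightarrow> is_Horizontal (walls n)"
    using periodic_tunnel_types[OF assms] by blast
  obtain n0 where n0: "\<And>n. n0 \<le> n \<Longrightarrow> outside_disc r (walls n)"
    using eventually_outside_disc[OF inj_walls] by blast
  define f where "f n = length (filter is_Vertical (map walls [0..<n]))" for n
  have "is_Vertical w \<longleftrightarrow> \<not> is_Horizontal w" for w
    by (cases w) auto
  then have per: "is_Vertical (walls (n + k)) = is_Vertical (walls n)" if "n0 \<le> n" for n
    using per0[OF n0[OF that]] by simp
  obtain a :: nat and G :: real where G: "\<And>n. \<bar>real k * real (f n) - real a * real n\<bar> \<le> G"
    by (rule periodic_count[OF \<open>0 < k\<close>, of f "\<lambda>n. is_Vertical (walls n)" n0])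
      (use per in \<open>auto simp: f_def\<close>)
  define D where "D = real k * (2 - 4 * \<delta>) - real a * (6 - 24 * \<delta>)"
  \<comment> \<open>The generous 100 absorbs the terms in \<mu> and \<open>V0\<close>, with |\<mu>|
    at most 2 and \<open>V0\<close> at most 14.\<close>
  define G' where "G' = 3 * (G + real k * (real (f (block_start 0)) + 100) + real a * (real (block_start 0) + 100))"
  have bound: "\<bar>D * real (block_column n)\<bar> \<le> G'" for n
  proof -
    obtain c m :: nat where cm:
      "block_column n = block_column 0 + 3 * c + 20 * m"
      "int m = \<lfloor>z (block_column n)\<rfloor> - \<lfloor>z (block_column 0)\<rfloor>"
      "block_start n = block_start 0 + 6 * c + 32 * m"
      "length (filter is_Vertical (hits (block_event n))) =
       length (filter is_Vertical (hits (block_event 0))) + 2 * c + 12 * m"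
      by (rule block_counts)
    have f: "f (block_start n) = length (filter is_Vertical (hits (block_event n)))" for n
      using hits_eq[of "block_event n"] by (simp add: f_def block_start_def)
    define V where "V = real (block_column n)"
    define \<mu> where "\<mu> = real m - \<delta> * V"
    define V0 where "V0 = real (block_column 0)"
    have \<mu>: "\<bar>\<mu>\<bar> \<le> 2"
      using long_gap_count[OF cm(2)] by (simp add: \<mu>_def V_def)
    have V0: "0 \<le> V0" "V0 \<le> 14"
      using length_first_gaps by (simp_all add: V0_def block_column.simps(1))
    have m: "real m = \<delta> * V + \<mu>"
      by (simp add: \<mu>_def)
    have c: "3 * real c = V - V0 - 20 * (\<delta> * V + \<mu>)"
      unfolding m[symmetric] using cm(1) by (simp add: V_def V0_def)
    have fN: "3 * real (f (block_start n)) =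
        (2 - 4 * \<delta>) * V + (3 * real (f (block_start 0)) - 2 * V0 - 4 * \<mu>)"
      using cm(4) c m by (simp add: f algebra_simps)
    have N: "3 * real (block_start n) =
        (6 - 24 * \<delta>) * V + (3 * real (block_start 0) - 6 * V0 - 24 * \<mu>)"
      using cm(3) c m by (simp add: algebra_simps)
    define e1 e2 where "e1 = 3 * real (f (block_start 0)) - 2 * V0 - 4 * \<mu>"
      and "e2 = 3 * real (block_start 0) - 6 * V0 - 24 * \<mu>"
    have e: "\<bar>e1\<bar> \<le> 3 * (real (f (block_start 0)) + 100)" "\<bar>e2\<bar> \<le> 3 * (real (block_start 0) + 100)"
      using \<mu> V0 by (auto simp: e1_def e2_def abs_le_iff)
    have "\<bar>real k * e1\<bar> \<le> real k * (3 * (real (f (block_start 0)) + 100))"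
      "\<bar>real a * e2\<bar> \<le> real a * (3 * (real (block_start 0) + 100))"
      using mult_left_mono[OF e(1), of "real k"] mult_left_mono[OF e(2), of "real a"]
      by (simp_all add: abs_mult)
    moreover have "D * V = 3 * (real k * real (f (block_start n)) - real a * real (block_start n)) -
        real k * e1 + real a * e2"
    proof -
      have "3 * (real k * real (f (block_start n)) - real a * real (block_start n)) =
          real k * (3 * real (f (block_start n))) - real a * (3 * real (block_start n))"
        by simp
      also have "\<dots> = real k * ((2 - 4 * \<delta>) * V + e1) - real a * ((6 - 24 * \<delta>) * V + e2)"
        unfolding fN N e1_def e2_def ..
      finally show ?thesis
        by (simp add: D_def algebra_simps)
    qed
    ultimately show ?thesis
      unfolding V_def[symmetric] G'_def using G[of "block_start n"]
      by (simp add: abs_le_iff algebra_simps)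
  qed
  have "D = 0"
  proof (rule ccontr)
    assume "D \<noteq> 0"
    have "n \<le> block_column n" for n
    proof (induction n)
      case (Suc n)
      then show ?case by (simp add: block_column.simps(2) block_gaps_def)
    qed simp
    then have "\<bar>D\<bar> * real n \<le> \<bar>D\<bar> * real (block_column n)" for n
      by (simp add: mult_left_mono)
    then have "\<bar>D\<bar> * real n \<le> G'" for n
      by (rule order_trans[OF _ bound[of n, unfolded abs_mult abs_of_nat]])
    moreover obtain n where "G' < real n * \<bar>D\<bar>"
      using reals_Archimedean3[of "\<bar>D\<bar>"] \<open>D \<noteq> 0\<close> by auto
    ultimately show False
      by (metis mult.commute linorder_not_le)
  qed
  then have *: "\<delta> * (24 * real a - 4 * real k) = 6 * real a - 2 * real k"
    by (simp add: D_def algebra_simps)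
  \<comment> \<open>If 24 a = 4 k, then 6 a - 2 k = -k, contrary to k > 0.\<close>
  have "24 * real a - 4 * real k \<noteq> 0"
  proof
    assume eq: "24 * real a - 4 * real k = 0"
    then have "6 * real a - 2 * real k = 0"
      using * by (simp only: mult_zero_right)
    with eq \<open>0 < k\<close> show False
      by simp
  qed
  then have "\<delta> = (6 * real a - 2 * real k) / (24 * real a - 4 * real k)"
    using * by (simp add: field_simps)
  then show ?thesis
    by simp
qed

end

section \<open>Exceptional slopes and conclusion\<close>

lemma countable_lattice_slopes:
  assumes "(x0::real) < 1"
  shows "countable {s. \<exists>v h::nat. (real v + 1 - x0) * s = real h + 1 - y0}"
proof -
  have "{s. \<exists>v h::nat. (real v + 1 - x0) * s = real h + 1 - y0} \<subseteq>
    (\<lambda>(v::nat, h::nat). (real h + 1 - y0) / (real v + 1 - x0)) ` UNIV"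
  proof (rule subsetI)
    fix s assume "s \<in> {s. \<exists>v h::nat. (real v + 1 - x0) * s = real h + 1 - y0}"
    then obtain v h :: nat where "(real v + 1 - x0) * s = real h + 1 - y0"
      by blast
    moreover have "real v + 1 - x0 \<noteq> 0"
      using assms by simp
    ultimately have "s = (real h + 1 - y0) / (real v + 1 - x0)"
      by (simp add: field_simps)
    then show "s \<in> (\<lambda>(v::nat, h::nat). (real h + 1 - y0) / (real v + 1 - x0)) ` UNIV"
      by (intro image_eqI[of _ _ "(v, h)"]) auto
  qed
  then show ?thesis
    by (rule countable_subset) simp
qed

theorem theorem1p2:
  fixes P :: "real \<times> real"
  assumes "P \<in> interior ({0..1} \<times> {0..1})"
  shows "(\<exists>\<epsilon>::real. 0 < \<epsilon> \<and> \<epsilon> \<le> 1 / 17 \<and>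
           countable {s \<in> {3..3 + \<epsilon>}.
             \<not> (\<exists>W. tunnels P s W \<and> tunnel_has_slope W (1 + (3 * s - 9) / (25 - 8 * s)))} \<and>
           (\<forall>s \<in> {3..3 + \<epsilon>}. \<forall>W. tunnels P s W \<longrightarrow>
             (s \<in> \<rat> \<longrightarrow> periodic_tunnel W) \<and> (s \<notin> \<rat> \<longrightarrow> \<not> periodic_tunnel W))) \<and>
         uncountable {s. \<exists>W. tunnels P s W \<and> \<not> periodic_tunnel W}"
proof -
  obtain x0 y0 where P: "P = (x0, y0)"
    by (cases P)
  have xy: "0 < x0" "x0 < 1" "0 < y0" "y0 < 1"
    using assms by (auto simp: P interior_Times)
  \<comment> \<open>The divisor 21 exceeds both 14 and 20, which makes the two strict bounds of
    \<open>steep_trajectory\<close> hold at the right end of the interval too.\<close>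
  define \<epsilon> where "\<epsilon> = (1 - frac (y0 - 3 * x0)) / 21"
  have \<epsilon>: "0 < \<epsilon>" "\<epsilon> \<le> 1 / 21"
    using frac_lt_1[of "y0 - 3 * x0"] frac_ge_0[of "y0 - 3 * x0"] by (simp_all add: \<epsilon>_def)
  define exceptional where "exceptional = {s. \<exists>v h::nat. (real v + 1 - x0) * s = real h + 1 - y0}"
  have countable: "countable exceptional"
    unfolding exceptional_def using countable_lattice_slopes xy by blast
  have steep: "steep_trajectory x0 y0 s (s - 3)" if "s \<in> {3..3 + \<epsilon>}" "s \<notin> exceptional" for s
  proof
    show "frac (y0 - 3 * x0) + 14 * (s - 3) < 1"
      using that \<epsilon> by (auto simp: \<epsilon>_def field_simps)
    show "20 * (s - 3) < 1"
      using that \<epsilon> by auto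
  qed (use that xy in \<open>auto simp: exceptional_def\<close>)
  \<comment> \<open>The claims on periodicity concern every tunnel with slope in the interval; at an
    exceptional slope there is no collision sequence at all.\<close>
  have unique: "W = trajectory.walls x0 y0 s \<and> s \<notin> exceptional"
    if s: "s \<in> {3..3 + \<epsilon>}" and W: "tunnels P s W" for s W
  proof -
    have seq: "collision_sequence (x0, y0) s W"
      using W by (simp add: tunnels_def P)
    have "s \<notin> exceptional"
    proof
      assume "s \<in> exceptional"
      then obtain v h :: nat where "(real v + 1 - x0) * s = real h + 1 - y0"
        by (auto simp: exceptional_def)
      then have "y0 + s * (real v + 1 - x0) = real (h + 1)" "x0 + (real v + 1 - x0) = real (v + 1)"
        by (simp_all add: algebra_simps)
      then have "x0 + (real v + 1 - x0) \<in> \<int>" "y0 + s * (real v + 1 - x0) \<in> \<int>"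
        by (simp_all only: Ints_of_nat)
      then show False
        using collision_sequence_avoids_lattice[OF seq, of "real v + 1 - x0"] s xy by simp
    qed
    interpret steep_trajectory x0 y0 s "s - 3"
      by (rule steep) fact+
    show ?thesis
      using collision_sequence_unique[OF seq collision_sequence_walls[OF unbounded_hits]]
        \<open>s \<notin> exceptional\<close> by blast
  qed
  have Rats: "s - 3 \<in> \<rat> \<longleftrightarrow> s \<in> \<rat>" for s :: real
    using Rats_add[of "s - 3" 3] Rats_diff[of s 3] by auto
  have tunnel: "tunnels P s (trajectory.walls x0 y0 s) \<and>
      tunnel_has_slope (trajectory.walls x0 y0 s) (1 + (3 * s - 9) / (25 - 8 * s)) \<and>
      (periodic_tunnel (trajectory.walls x0 y0 s) \<longleftrightarrow> s \<in> \<rat>)"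
    if "s \<in> {3..3 + \<epsilon>}" "s \<notin> exceptional" for s
  proof -
    interpret steep_trajectory x0 y0 s "s - 3"
      by (rule steep) fact+
    show ?thesis
      using tunnels_walls tunnel_has_slope_walls periodic_walls periodic_walls_imp_rational Rats
      by (auto simp: P)
  qed
  have "{s \<in> {3..3 + \<epsilon>}. \<not> (\<exists>W. tunnels P s W \<and> tunnel_has_slope W (1 + (3 * s - 9) / (25 - 8 * s)))}
      \<subseteq> exceptional"
    using tunnel by blast
  then have 1: "countable {s \<in> {3..3 + \<epsilon>}.
      \<not> (\<exists>W. tunnels P s W \<and> tunnel_has_slope W (1 + (3 * s - 9) / (25 - 8 * s)))}"
    using countable countable_subset by blast
  have 2: "(s \<in> \<rat> \<longrightarrow> periodic_tunnel W) \<and> (s \<notin> \<rat> \<longrightarrow> \<not> periodic_tunnel W)"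
    if "s \<in> {3..3 + \<epsilon>}" "tunnels P s W" for s W
    using unique[OF that] tunnel[of s] that by blast
  have "uncountable ({3..3 + \<epsilon>} - (exceptional \<union> \<rat>))"
    using \<epsilon> countable countable_rat by (intro uncountable_minus_countable) (auto simp: uncountable_closed_interval)
  moreover have "{3..3 + \<epsilon>} - (exceptional \<union> \<rat>) \<subseteq> {s. \<exists>W. tunnels P s W \<and> \<not> periodic_tunnel W}"
    using tunnel by blast
  ultimately have 3: "uncountable {s. \<exists>W. tunnels P s W \<and> \<not> periodic_tunnel W}"
    using countable_subset by blast
  show ?thesis
    using \<epsilon> 1 2 3 by (intro conjI exI[of _ \<epsilon>]) auto
qed

end
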